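(* For a composition $\alpha$, let $RT(\alpha)$ be the set of standard ribbon tableaux of shape $\alpha$. For $T\in RT(\alpha)$, the set $\mathbf B(T)=\{\,w\in\mathbf W\mid Q(w)=T\,\}$ is isomorphic to $\mathbf B(\alpha)$ as a $\mathfrak{gl}_{\mathcal N}$-crystal. Hence, as a $\mathfrak{gl}_{\mathcal N}$-crystal, $$\mathbf W=\bigoplus_{\alpha\in\mathcal C}\ \bigoplus_{T\in RT(\alpha)}\mathbf B(T),$$ where $\mathcal C$ is the set of compositions.
   Context: $\mathcal N=\frac12\mathbb Z_{>0}$ with its usual linear order; elements of $\mathbb Z_{>0}$ are even, elements of $\frac12+\mathbb Z_{\ge0}$ are odd. $I=\frac12\mathbb Z_{>0}$. $P=\bigoplus_{b\in\mathcal N}\mathbb Z\epsilon_b$ with $(\epsilon_a,\epsilon_b)=(-1)^{|a|}\delta_{ab}$ ($|a|$ the parity). Simple roots: $\alpha_i=\epsilon_i-\epsilon_{i+\frac12}$, $i\in I$. A $\mathfrak{gl}_{\mathcal N}$-crystal is a set $B$ with maps $\mathrm{wt}:B\to P$, $\varepsilon_i,\varphi_i:B\to\mathbb Z_{\ge0}$, $e_i,f_i:B\to B\cup\{\mathbf 0\}$ ($i\in I$; $\mathbf 0$ a formal symbol) such that: (1) $\varphi_i(b)+\varepsilon_i(b)$ is $1$ if $(\mathrm{wt}(b),\alpha_i)\ne0$ and $0$ otherwise; (2) if $e_ib\in B$ then $\varepsilon_i(e_ib)=\varepsilon_i(b)-1$, $\varphi_i(e_ib)=\varphi_i(b)+1$,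 $\mathrm{wt}(e_ib)=\mathrm{wt}(b)+\alpha_i$; (3) if $f_ib\in B$ then $\varepsilon_i(f_ib)=\varepsilon_i(b)+1$, $\varphi_i(f_ib)=\varphi_i(b)-1$, $\mathrm{wt}(f_ib)=\mathrm{wt}(b)-\alpha_i$; (4) $f_ib=b'$ iff $b=e_ib'$. It is viewed as an $I$-colored oriented graph ($b\xrightarrow{i}b'$ iff $b'=f_ib$). An isomorphism of crystals is an isomorphism of colored oriented graphs preserving $\mathrm{wt},\varepsilon_i,\varphi_i$. $\bigoplus$ denotes disjoint union of crystals (subsets stable under all $e_i,f_i$ up to $\mathbf 0$). Crystal of words: $\mathbf W$ is the set of finite words in $\mathcal N$ (including the empty word), $\mathrm{wt}(w_1\cdots w_r)=\sum_k\epsilon_{w_k}$. On letters, $f_i(i)=i+\frac12$, $e_i(i+\frac12)=i$, all other $e_i,f_i$ give $\mathbf 0$. On $w=w_1\cdots w_r$: for $i\in\mathbb Z_{>0}$ (resp. $i\in\frac12+\mathbb Z_{\ge0}$) let $k$ be the smallest (resp. largest) index with $w_k\in\{i,i+\frac12\}$; $e_iw$, $f_iw$ are obtained by applying $e_i$, $f_i$ to $w_k$ ($\mathbf 0$ if that gives $\mathbf 0$); if no such $k$ exists, $e_iw=f_iw=\mathbf 0$. $\varepsilon_i(w)=1$ if $e_iw\neq\mathbf 0$, else $0$; $\varphi_i(w)=1$ if $f_iw\ne\mathbf 0$, else $0$. A composition $\alpha=(\alpha_1,\dots,\alpha_t)$ (finite sequence of positive integers, the empty one allowed) is identified with its ribbon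 diagram: rows from top to bottom have $\alpha_1,\dots,\alpha_t$ nodes, and the leftmost node of row $i+1$ is directly below the rightmost node of row $i$. A quasi-ribbon tableau of shape $\alpha$ is a filling with entries in $\mathcal N$ weakly increasing along rows (left to right) and columns (top to bottom), with integers strictly increasing in each column and odd half-integers strictly increasing in each row; $\mathbf B(\alpha)$ is the set of these. $w(T)$ is the word obtained by reading rows from top to bottom, each row right to left; $\mathbf B(\alpha)$ is a $\mathfrak{gl}_{\mathcal N}$-crystal by identifying $T$ with $w(T)\in\mathbf W$. A standard ribbon tableau of shape $\alpha$ (with $r=\sum\alpha_i$ nodes) is a bijective filling of the ribbon diagram with $\{1,\dots,r\}$ whose entries decrease from left to right in each row and increase from top to bottom in each column. Insertion: let $t_1,t_2,\dots$ be the entries of a quasi-ribbon tableau $T$ from northwest to southeast. For $b\in\mathcal N$, let $k$ be the smallest index with $b\le t_k$ if $b\in\mathbb Z_{>0}$, resp. $b<t_k$ if $b\in\frac12+\mathbb Z_{\ge0}$ (if none, $k-1$ is the number of nodes of $T$). Then $b\to T$ is the quasi-ribbon tableau obtained by gluing the sub-tableau of the first $k-1$ nodes, the node $b$, and the sub-tableau of the remaining nodes, $b$ being directly below the last node of the former and directly left of the first node of the latter. For $w=w_1\cdots w_r$, $P(w)=w_r\to(\cdots\to(w_2\to w_1))$, and $Q(w)$ is the standard ribbon tableau of the same shape as $P(w)$ in which a node is filled with $i$ if the corresponding node of $P(w)$ is occupied by the inserted letter $w_i$. For the empty word both are the empty tableau. *)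

theory Defs
  imports Complex_Main "HOL-Library.Poly_Mapping" "HOL-Library.Disjoint_Sets"
begin

section \<open>The linearly ordered set of positive half-integers\<close>

text \<open>The type serves both as the alphabet and as the set of colors.\<close>

typedef letter = "{q :: rat. \<exists>n :: nat. 0 < n \<and> q = of_nat n / 2}"
  by (rule exI[of _ "1/2"]) (auto intro!: exI[of _ 1])

instantiation letter :: linorder
begin

definition less_eq_letter :: "letter \<Rightarrow> letter \<Rightarrow> bool" where
  "a \<le> b \<longleftrightarrow> Rep_letter a \<le> Rep_letter b"

definition less_letter :: "letter \<Rightarrow> letter \<Rightarrow> bool" where
  "a < b \<longleftrightarrow> Rep_letter a < Rep_letter b"

instance
  by standard (auto simp: less_eq_letter_def less_letter_def Rep_letter_inject)

end

definition even_letter :: "letter \<Rightarrow> bool" where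
  "even_letter a \<longleftrightarrow> Rep_letter a \<in> \<int>"

definition half_up :: "letter \<Rightarrow> letter" where
  "half_up a = Abs_letter (Rep_letter a + 1/2)"

lemma Rep_half_up: "Rep_letter (half_up a) = Rep_letter a + 1/2"
proof -
  obtain n :: nat where "0 < n" "Rep_letter a = of_nat n / 2"
    using Rep_letter[of a] by auto
  then have "Rep_letter a + 1/2 \<in> {q. \<exists>n :: nat. 0 < n \<and> q = of_nat n / 2}"
    by (auto intro!: exI[of _ "Suc n"] simp: field_simps)
  then show ?thesis
    by (simp add: half_up_def Abs_letter_inverse)
qed


section \<open>Weights and crystals\<close>

type_synonym weight = "letter \<Rightarrow>\<^sub>0 int"

abbreviation epsilon :: "letter \<Rightarrow> weight" where
  "epsilon a \<equiv> Poly_Mapping.single a 1"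

definition weight_form :: "weight \<Rightarrow> weight \<Rightarrow> int" where
  "weight_form x y = (\<Sum>a \<in> Poly_Mapping.keys x.
     (if even_letter a then 1 else -1) * Poly_Mapping.lookup x a * Poly_Mapping.lookup y a)"

definition simple_root :: "letter \<Rightarrow> weight" where
  "simple_root i = epsilon i - epsilon (half_up i)"

text \<open>The formal symbol \<open>\<zero>\<close> is \<^const>\<open>None\<close>.\<close>

record 'b crystal =
  elts :: "'b set"
  wt :: "'b \<Rightarrow> weight"
  eps :: "letter \<Rightarrow> 'b \<Rightarrow> nat"
  phi :: "letter \<Rightarrow> 'b \<Rightarrow> nat"
  e_op :: "letter \<Rightarrow> 'b \<Rightarrow> 'b option"
  f_op :: "letter \<Rightarrow> 'b \<Rightarrow> 'b option"

definition stable :: "'b crystal \<Rightarrow> 'b set \<Rightarrow> bool" where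
  "stable C S \<longleftrightarrow>
     (\<forall>i. \<forall>b \<in> S. e_op C i b \<in> insert None (Some ` S) \<and> f_op C i b \<in> insert None (Some ` S))"

definition is_crystal :: "'b crystal \<Rightarrow> bool" where
  "is_crystal C \<longleftrightarrow> stable C (elts C) \<and>
     (\<forall>i. \<forall>b \<in> elts C. phi C i b + eps C i b =
        (if weight_form (wt C b) (simple_root i) \<noteq> 0 then 1 else 0)) \<and>
     (\<forall>i. \<forall>b \<in> elts C. \<forall>b' \<in> elts C. e_op C i b = Some b' \<longrightarrow>
        int (eps C i b') = int (eps C i b) - 1 \<and>
        int (phi C i b') = int (phi C i b) + 1 \<and>
        wt C b' = wt C b + simple_root i) \<and>
     (\<forall>i. \<forall>b \<in> elts C. \<forall>b' \<in> elts C. f_op C i b = Some b' \<longrightarrow>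
        int (eps C i b') = int (eps C i b) + 1 \<and>
        int (phi C i b') = int (phi C i b) - 1 \<and>
        wt C b' = wt C b - simple_root i) \<and>
     (\<forall>i. \<forall>b \<in> elts C. \<forall>b' \<in> elts C. f_op C i b = Some b' \<longleftrightarrow> e_op C i b' = Some b)"

definition crystal_isomorphic :: "'b crystal \<Rightarrow> 'c crystal \<Rightarrow> bool" where
  "crystal_isomorphic C D \<longleftrightarrow> is_crystal C \<and> is_crystal D \<and>
     (\<exists>h. bij_betw h (elts C) (elts D) \<and>
        (\<forall>b \<in> elts C. wt D (h b) = wt C b) \<and>
        (\<forall>i. \<forall>b \<in> elts C. eps D i (h b) = eps C i b \<and> phi D i (h b) = phi C i b) \<and>
        (\<forall>i. \<forall>b \<in> elts C. \<forall>b' \<in> elts C.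
           f_op C i b = Some b' \<longleftrightarrow> f_op D i (h b) = Some (h b')))"

definition subcrystal :: "'b crystal \<Rightarrow> 'b set \<Rightarrow> 'b crystal" where
  "subcrystal C S = C\<lparr>elts := S\<rparr>"

definition is_direct_sum :: "'b crystal \<Rightarrow> 'k set \<Rightarrow> ('k \<Rightarrow> 'b set) \<Rightarrow> bool" where
  "is_direct_sum C K S \<longleftrightarrow> is_crystal C \<and>
     (\<forall>k \<in> K. stable C (S k)) \<and> disjoint_family_on S K \<and> elts C = (\<Union>k \<in> K. S k)"


section \<open>The crystal of words\<close>

type_synonym word = "letter list"

definition e_letter :: "letter \<Rightarrow> letter \<Rightarrow> letter option" where
  "e_letter i a = (if a = half_up i then Some i else None)"

definition f_letter :: "letter \<Rightarrow> letter \<Rightarrow> letter option" where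
  "f_letter i a = (if a = i then Some (half_up i) else None)"

definition active_positions :: "letter \<Rightarrow> word \<Rightarrow> nat set" where
  "active_positions i w = {k. k < length w \<and> w ! k \<in> {i, half_up i}}"

definition word_op :: "(letter \<Rightarrow> letter option) \<Rightarrow> letter \<Rightarrow> word \<Rightarrow> word option" where
  "word_op g i w =
     (if active_positions i w = {} then None
      else let k = (if even_letter i then Min (active_positions i w)
                    else Max (active_positions i w))
           in map_option (\<lambda>a. w[k := a]) (g (w ! k)))"

definition word_crystal :: "word crystal" where
  "word_crystal = \<lparr>
     elts = UNIV,
     wt = (\<lambda>w. \<Sum>a \<leftarrow> w. epsilon a),
     eps = (\<lambda>i w. if word_op (e_letter i) i w \<noteq> None then 1 else 0),
     phi = (\<lambda>i w. if word_op (f_letter i) i w \<noteq> None then 1 else 0),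
     e_op = (\<lambda>i w. word_op (e_letter i) i w),
     f_op = (\<lambda>i w. word_op (f_letter i) i w)\<rparr>"


section \<open>Ribbon tableaux\<close>

definition compositions :: "nat list set" where
  "compositions = {\<alpha>. \<forall>a \<in> set \<alpha>. 0 < a}"

text \<open>
  Rows are numbered from \<open>0\<close> downwards, columns from \<open>0\<close> to the right.
  \<open>ribbon_col \<alpha> i\<close> is the column of the leftmost node of row \<open>i\<close>, which is the column
  of the rightmost node of row \<open>i - 1\<close>.
\<close>

definition ribbon_col :: "nat list \<Rightarrow> nat \<Rightarrow> nat" where
  "ribbon_col \<alpha> i = (\<Sum>k<i. \<alpha> ! k - 1)"

definition ribbon :: "nat list \<Rightarrow> (nat \<times> nat) set" where
  "ribbon \<alpha> = {(i, j). i < length \<alpha> \<and> ribbon_col \<alpha> i \<le> j \<and> j < ribbon_col \<alpha> i + \<alpha> ! i}"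

text \<open>
  A filling of a ribbon diagram is the list of its rows from top to bottom, each read from
  left to right; \<open>concat T\<close> thus lists the entries from northwest to southeast.
\<close>

definition fillings :: "nat list \<Rightarrow> 'a list list set" where
  "fillings \<alpha> = {T. map length T = \<alpha>}"

definition entry :: "'a list list \<Rightarrow> nat \<times> nat \<Rightarrow> 'a" where
  "entry T = (\<lambda>(i, j). T ! i ! (j - ribbon_col (map length T) i))"

definition quasi_ribbon_tableaux :: "nat list \<Rightarrow> letter list list set" where
  "quasi_ribbon_tableaux \<alpha> = {T \<in> fillings \<alpha>.
     (\<forall>i j j'. (i, j) \<in> ribbon \<alpha> \<and> (i, j') \<in> ribbon \<alpha> \<and> j < j' \<longrightarrow>
        entry T (i, j) \<le> entry T (i, j') \<and>
        (\<not> even_letter (entry T (i, j)) \<and> \<not> even_letter (entry T (i, j')) \<longrightarrow>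
           entry T (i, j) < entry T (i, j'))) \<and>
     (\<forall>i i' j. (i, j) \<in> ribbon \<alpha> \<and> (i', j) \<in> ribbon \<alpha> \<and> i < i' \<longrightarrow>
        entry T (i, j) \<le> entry T (i', j) \<and>
        (even_letter (entry T (i, j)) \<and> even_letter (entry T (i', j)) \<longrightarrow>
           entry T (i, j) < entry T (i', j)))}"

definition standard_ribbon_tableaux :: "nat list \<Rightarrow> nat list list set" where
  "standard_ribbon_tableaux \<alpha> = {T \<in> fillings \<alpha>.
     bij_betw (entry T) (ribbon \<alpha>) {1..sum_list \<alpha>} \<and>
     (\<forall>i j j'. (i, j) \<in> ribbon \<alpha> \<and> (i, j') \<in> ribbon \<alpha> \<and> j < j' \<longrightarrow>
        entry T (i, j) > entry T (i, j')) \<and>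
     (\<forall>i i' j. (i, j) \<in> ribbon \<alpha> \<and> (i', j) \<in> ribbon \<alpha> \<and> i < i' \<longrightarrow>
        entry T (i, j) < entry T (i', j))}"

definition reading :: "'a list list \<Rightarrow> 'a list" where
  "reading T = concat (map rev T)"

text \<open>
  The operators apply those of words to \<open>reading T\<close> and put the resulting word back into the
  ribbon \<open>\<alpha>\<close>; that the result is again a quasi-ribbon tableau is not built in.
\<close>

definition tableau_crystal :: "nat list \<Rightarrow> letter list list crystal" where
  "tableau_crystal \<alpha> = \<lparr>
     elts = quasi_ribbon_tableaux \<alpha>,
     wt = (\<lambda>T. wt word_crystal (reading T)),
     eps = (\<lambda>i T. eps word_crystal i (reading T)),
     phi = (\<lambda>i T. phi word_crystal i (reading T)),
     e_op = (\<lambda>i T. map_option (the_inv_into (fillings \<alpha>) reading)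
                     (e_op word_crystal i (reading T))),
     f_op = (\<lambda>i T. map_option (the_inv_into (fillings \<alpha>) reading)
                     (f_op word_crystal i (reading T)))\<rparr>"

lemma inj_on_reading: "inj_on reading (fillings \<alpha>)"
proof (rule inj_onI)
  fix T U :: "'a list list"
  assume "T \<in> fillings \<alpha>" "U \<in> fillings \<alpha>" and eq: "reading T = reading U"
  then have "map length T = map length U" by (simp add: fillings_def)
  then have "length T = length U" by (metis length_map)
  then show "T = U"
    using \<open>map length T = map length U\<close> eq
    by (induction T U rule: list_induct2) (simp_all add: reading_def)
qed


section \<open>Insertion\<close>

text \<open>\<open>first_nodes n T\<close> and \<open>rest_nodes n T\<close> cut \<open>T\<close> after its first \<open>n\<close> nodes.\<close>

fun first_nodes :: "nat \<Rightarrow> 'a list list \<Rightarrow> 'a list list" where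
  "first_nodes n [] = []"
| "first_nodes n (r # T) =
     (if n = 0 then []
      else if n \<le> length r then [take n r]
      else r # first_nodes (n - length r) T)"

fun rest_nodes :: "nat \<Rightarrow> 'a list list \<Rightarrow> 'a list list" where
  "rest_nodes n [] = []"
| "rest_nodes n (r # T) =
     (if n < length r then drop n r # T else rest_nodes (n - length r) T)"

fun attach_left :: "'a \<Rightarrow> 'a list list \<Rightarrow> 'a list list" where
  "attach_left b [] = [[b]]"
| "attach_left b (r # T) = (b # r) # T"

definition glue :: "nat \<Rightarrow> 'a \<Rightarrow> 'a list list \<Rightarrow> 'a list list" where
  "glue n b T = first_nodes n T @ attach_left b (rest_nodes n T)"

text \<open>The number of nodes preceding the first \<open>t\<close> with \<open>b \<le> t\<close>, respectively \<open>b < t\<close>.\<close>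

definition insert_pos :: "letter \<Rightarrow> letter list list \<Rightarrow> nat" where
  "insert_pos b T =
     length (takeWhile (\<lambda>t. \<not> (if even_letter b then b \<le> t else b < t)) (concat T))"

definition insert_letter :: "letter \<Rightarrow> letter list list \<Rightarrow> letter list list" where
  "insert_letter b T = glue (insert_pos b T) b T"

definition P_tableau :: "word \<Rightarrow> letter list list" where
  "P_tableau w = fold insert_letter w []"

text \<open>
  To record which node is occupied by which letter of \<open>w\<close>, the insertion is run on the pairs
  \<open>(w\<^sub>k, k)\<close>, where the second components do not influence the insertion.
\<close>

definition insert_labelled ::
  "letter \<times> nat \<Rightarrow> (letter \<times> nat) list list \<Rightarrow> (letter \<times> nat) list list" where
  "insert_labelled p T = glue (insert_pos (fst p) (map (map fst) T)) p T"

definition labelled_tableau :: "word \<Rightarrow> (letter \<times> nat) list list" where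
  "labelled_tableau w = fold insert_labelled (zip w [1..<length w + 1]) []"

definition Q_tableau :: "word \<Rightarrow> nat list list" where
  "Q_tableau w = map (map snd) (labelled_tableau w)"

lemma map_glue: "map (map g) (glue n b T) = glue n (g b) (map (map g) T)"
proof -
  have "map (map g) (first_nodes n T) = first_nodes n (map (map g) T)"
    by (induction T arbitrary: n) (auto simp: take_map)
  moreover have "map (map g) (rest_nodes n T) = rest_nodes n (map (map g) T)"
    by (induction T arbitrary: n) (auto simp: drop_map)
  moreover have "map (map g) (attach_left b U) = attach_left (g b) (map (map g) U)" for U
    by (cases U) auto
  ultimately show ?thesis by (simp add: glue_def)
qed

lemma labelled_tableau_P: "map (map fst) (labelled_tableau w) = P_tableau w"
proof -
  have "map (map fst) (fold insert_labelled ps T) =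
          fold insert_letter (map fst ps) (map (map fst) T)" for ps T
    by (induction ps arbitrary: T)
       (auto simp: insert_labelled_def insert_letter_def map_glue)
  moreover have "map fst (zip w [1..<length w + 1]) = w"
    by (rule map_fst_zip) (simp del: upt_Suc)
  ultimately show ?thesis
    unfolding labelled_tableau_def P_tableau_def by (metis list.map(1))
qed

definition words_with_Q :: "nat list list \<Rightarrow> word set" where
  "words_with_Q T = {w. Q_tableau w = T}"

end

theory Submission
  imports Defs "HOL-Library.Multiset"
begin

text \<open>
  Insertion is a sorting procedure: read from northwest to southeast, the tableau \<open>P(w)\<close> lists the
  letters of \<open>w\<close> in increasing order, where equal even letters appear from right to left and equal
  odd letters from left to right, and \<open>Q(w)\<close> lists the positions in \<open>w\<close> of these letters. Two
  adjacent nodes lie in one row if and only if their labels decrease, so the labels alone determine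
  the shape. Hence \<open>w \<mapsto> P(w)\<close> identifies the words with a given recording tableau \<open>T\<close> with the
  quasi-ribbon tableaux of the shape of \<open>T\<close>.

  In this picture the nodes carrying \<open>i\<close> or \<open>i + 1/2\<close> form an interval on which the labels are
  first monotone in one direction and then in the other. The letter on which \<open>e\<^sub>i\<close> and \<open>f\<^sub>i\<close> act is
  therefore the one at the turning point. Its node depends only on \<open>P(w)\<close> and on the descents of
  the labels, that is, on the shape. The reading word of \<open>P(w)\<close> spells the same tableau with another
  standard labelling of the same shape, so both words undergo the same change.
\<close>

section \<open>Letters\<close>

lemma less_half_up: "i < half_up i"
  by (simp add: less_letter_def Rep_half_up)

lemma half_up_neq [simp]: "half_up i \<noteq> i" "i \<noteq> half_up i"
  using less_half_up[of i] by auto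

lemma Rep_letter_nat: obtains n :: nat where "Rep_letter a = of_nat n / 2"
  using Rep_letter[of a] by auto

text \<open>Doubling turns letters into positive integers and \<open>half_up\<close> into the
  successor map, so no letter lies strictly between \<open>i\<close> and
  \<open>half_up i\<close>.\<close>

lemma less_half_up_iff: "a < half_up i \<longleftrightarrow> a \<le> i"
proof -
  obtain m n :: nat where ra: "Rep_letter a = of_nat m / 2" and ri: "Rep_letter i = of_nat n / 2"
    using Rep_letter_nat by metis
  have "a \<le> i \<longleftrightarrow> m \<le> n" "a < half_up i \<longleftrightarrow> rat_of_nat m < of_nat n + 1"
    unfolding less_letter_def less_eq_letter_def Rep_half_up ra ri by (simp_all add: field_simps)
  moreover have "rat_of_nat m < of_nat n + 1 \<longleftrightarrow> m \<le> n"
    by (metis Suc_eq_plus1 less_Suc_eq_le of_nat_1 of_nat_add of_nat_less_iff)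
  ultimately show ?thesis
    by simp
qed

lemma half_in_Ints_iff: "(of_nat n / 2 :: rat) \<in> \<int> \<longleftrightarrow> even n"
proof
  assume "(of_nat n / 2 :: rat) \<in> \<int>"
  then obtain k where "(of_nat n / 2 :: rat) = of_int k"
    by (auto elim: Ints_cases)
  then have "rat_of_int (int n) = of_int (2 * k)"
    by (simp add: field_simps)
  then have "int n = 2 * k"
    by (simp only: of_int_eq_iff)
  then show "even n" by presburger
qed (auto elim!: evenE)

lemma even_half_up [simp]: "even_letter (half_up i) \<longleftrightarrow> \<not> even_letter i"
proof -
  obtain n :: nat where n: "Rep_letter i = of_nat n / 2"
    using Rep_letter_nat by metis
  then have "Rep_letter (half_up i) = of_nat (Suc n) / 2"
    by (simp add: Rep_half_up field_simps)
  with n show ?thesis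
    unfolding even_letter_def by (simp only: half_in_Ints_iff even_Suc)
qed

section \<open>The crystal of words\<close>

lemma finite_active [simp]: "finite (active_positions i w)"
  by (simp add: active_positions_def)

text \<open>Positions as seen from the end of the word at which color \<open>i\<close> acts: the
  left end for even \<open>i\<close>, the right end for odd \<open>i\<close>. This merges the
  \<open>Min\<close> and \<open>Max\<close> cases of \<open>word_op\<close> into one.\<close>

definition active_less :: "letter \<Rightarrow> nat \<Rightarrow> nat \<Rightarrow> bool" where
  "active_less i k l \<longleftrightarrow> (if even_letter i then k < l else l < k)"

definition first_active :: "letter \<Rightarrow> word \<Rightarrow> nat \<Rightarrow> bool" where
  "first_active i w k \<longleftrightarrow> k \<in> active_positions i w \<and>
     (\<forall>l \<in> active_positions i w. l = k \<or> active_less i k l)"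

lemma ex_first_active:
  assumes "active_positions i w \<noteq> {}"
  shows "\<exists>k. first_active i w k"
proof (cases "even_letter i")
  case True
  then have "first_active i w (Min (active_positions i w))"
    using assms by (auto simp: first_active_def active_less_def order_less_le)
  then show ?thesis ..
next
  case False
  then have "first_active i w (Max (active_positions i w))"
    using assms by (auto simp: first_active_def active_less_def order_less_le)
  then show ?thesis ..
qed

lemma word_op_first_active:
  assumes "first_active i w k"
  shows "word_op g i w = map_option (\<lambda>a. w[k := a]) (g (w ! k))"
proof -
  have "Min (active_positions i w) = k" if "even_letter i"
    using assms that
    by (intro Min_eqI) (auto simp: first_active_def active_less_def order_less_le)
  moreover have "Max (active_positions i w) = k" if "\<not> even_letter i"
    using assms that
    by (intro Max_eqI) (auto simp: first_active_def active_less_def order_less_le)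
  moreover have "active_positions i w \<noteq> {}"
    using assms by (auto simp: first_active_def)
  ultimately show ?thesis
    by (auto simp: word_op_def)
qed

lemma word_op_inactive: "active_positions i w = {} \<Longrightarrow> word_op g i w = None"
  by (simp add: word_op_def)

lemma active_positions_update:
  "k \<in> active_positions i w \<Longrightarrow> a \<in> {i, half_up i} \<Longrightarrow>
    active_positions i (w[k := a]) = active_positions i w"
  by (auto simp: active_positions_def nth_list_update)

lemma first_active_update:
  "first_active i w k \<Longrightarrow> a \<in> {i, half_up i} \<Longrightarrow> first_active i (w[k := a]) k"
  by (simp add: first_active_def active_positions_update)

lemma first_active_cases:
  obtains "active_positions i w = {}"
  | k where "first_active i w k" "k < length w" "w ! k = i"
  | k where "first_active i w k" "k < length w" "w ! k = half_up i"
proof (cases "active_positions i w = {}")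
  case False
  then obtain k where "first_active i w k"
    using ex_first_active by blast
  moreover from this have "k < length w" "w ! k = i \<or> w ! k = half_up i"
    by (auto simp: first_active_def active_positions_def)
  ultimately show ?thesis
    using that by blast
qed (use that in blast)

text \<open>Exchanging \<open>i\<close> and \<open>half_up i\<close> leaves the set of active
  positions unchanged, so the opposite operator selects the same position and restores the
  letter.\<close>

lemma word_op_f_iff_e:
  "word_op (f_letter i) i w = Some w' \<longleftrightarrow> word_op (e_letter i) i w' = Some w"
proof
  assume *: "word_op (f_letter i) i w = Some w'"
  show "word_op (e_letter i) i w' = Some w"
  proof (cases i w rule: first_active_cases)
    case (2 k)
    then have "w' = w[k := half_up i]"
      using * by (simp add: word_op_first_active f_letter_def)
    moreover have "first_active i (w[k := half_up i]) k"
      using 2 by (intro first_active_update) auto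
    moreover have "w[k := i] = w"
      using 2 by (metis list_update_id)
    ultimately show ?thesis
      using 2 by (simp add: word_op_first_active e_letter_def)
  qed (use * in \<open>auto simp: word_op_first_active word_op_inactive f_letter_def\<close>)
next
  assume *: "word_op (e_letter i) i w' = Some w"
  show "word_op (f_letter i) i w = Some w'"
  proof (cases i w' rule: first_active_cases)
    case (3 k)
    then have "w = w'[k := i]"
      using * by (simp add: word_op_first_active e_letter_def)
    moreover have "first_active i (w'[k := i]) k"
      using 3 by (intro first_active_update) auto
    moreover have "w'[k := half_up i] = w'"
      using 3 by (metis list_update_id)
    ultimately show ?thesis
      using 3 by (simp add: word_op_first_active f_letter_def)
  qed (use * in \<open>auto simp: word_op_first_active word_op_inactive e_letter_def\<close>)
qed

lemma phi_plus_eps_word: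
  "phi word_crystal i w + eps word_crystal i w = (if active_positions i w = {} then 0 else 1)"
  by (cases i w rule: first_active_cases)
     (auto simp: word_crystal_def word_op_first_active word_op_inactive
        e_letter_def f_letter_def first_active_def)

lemma lookup_wt_word: "Poly_Mapping.lookup (wt word_crystal w) a = int (count_list w a)"
  by (induction w) (auto simp: word_crystal_def lookup_add lookup_single)

text \<open>The letters \<open>i\<close> and \<open>half_up i\<close> have opposite parity, so the
  signs of the form turn the difference in the simple root into a sum. For the weight of a word both
  summands are counts and cannot cancel.\<close>

lemma weight_form_simple_root:
  "weight_form x (simple_root i) = (if even_letter i then 1 else -1) *
     (Poly_Mapping.lookup x i + Poly_Mapping.lookup x (half_up i))"
proof -
  define c :: "letter \<Rightarrow> int" where
    "c a = (if even_letter a then 1 else -1) * Poly_Mapping.lookup x a" for a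
  have "weight_form x (simple_root i) =
      (\<Sum>a \<in> Poly_Mapping.keys x. (if a = i then c a else 0) - (if a = half_up i then c a else 0))"
    unfolding weight_form_def simple_root_def c_def
    by (rule sum.cong) (auto simp: lookup_minus lookup_single when_def)
  also have "\<dots> = c i - c (half_up i)"
    by (auto simp: sum_subtractf sum.delta c_def in_keys_iff)
  finally show ?thesis
    by (simp add: c_def)
qed

lemma active_positions_empty_iff:
  "active_positions i w = {} \<longleftrightarrow> count_list w i = 0 \<and> count_list w (half_up i) = 0"
  by (auto simp: active_positions_def count_list_0_iff in_set_conv_nth)

lemma weight_form_wt_word:
  "weight_form (wt word_crystal w) (simple_root i) \<noteq> 0 \<longleftrightarrow> active_positions i w \<noteq> {}"
  by (auto simp: weight_form_simple_root lookup_wt_word active_positions_empty_iff)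

lemma wt_word_update:
  assumes "k < length w"
  shows "wt word_crystal (w[k := a]) + epsilon (w ! k) = wt word_crystal w + epsilon a"
proof -
  have "wt word_crystal (w[k := a]) =
      wt word_crystal (take k w) + epsilon a + wt word_crystal (drop (Suc k) w)"
    using assms by (simp add: upd_conv_take_nth_drop word_crystal_def)
  moreover have "wt word_crystal w =
      wt word_crystal (take k w) + epsilon (w ! k) + wt word_crystal (drop (Suc k) w)"
    by (subst id_take_nth_drop[OF assms]) (simp add: word_crystal_def)
  ultimately show ?thesis
    by simp
qed

lemma f_word_SomeD:
  assumes "word_op (f_letter i) i w = Some w'"
  shows "eps word_crystal i w' = Suc (eps word_crystal i w)"
    and "phi word_crystal i w = Suc (phi word_crystal i w')"
    and "wt word_crystal w = wt word_crystal w' + simple_root i"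
proof -
  obtain k where k: "first_active i w k" "k < length w" "w ! k = i"
    using assms
    by (cases i w rule: first_active_cases)
       (auto simp: word_op_inactive word_op_first_active f_letter_def)
  then have w': "w' = w[k := half_up i]"
    using assms by (simp add: word_op_first_active f_letter_def)
  have "first_active i w' k"
    unfolding w' using k by (intro first_active_update) auto
  then show "eps word_crystal i w' = Suc (eps word_crystal i w)"
    and "phi word_crystal i w = Suc (phi word_crystal i w')"
    using k w' by (simp_all add: word_crystal_def word_op_first_active e_letter_def f_letter_def)
  have "wt word_crystal w' + epsilon i = wt word_crystal w + epsilon (half_up i)"
    using wt_word_update[OF k(2), of "half_up i"] by (simp add: w' k)
  then show "wt word_crystal w = wt word_crystal w' + simple_root i"
    by (simp add: simple_root_def algebra_simps)
qed

lemma is_crystal_word: "is_crystal word_crystal"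
proof -
  have *: "e_op word_crystal i w = word_op (e_letter i) i w"
    "f_op word_crystal i w = word_op (f_letter i) i w" for i w
    by (simp_all add: word_crystal_def)
  have "stable word_crystal (elts word_crystal)"
    by (simp add: stable_def word_crystal_def flip: UNIV_option_conv)
  then show ?thesis
    unfolding is_crystal_def * phi_plus_eps_word weight_form_wt_word
    \<comment> \<open>Reversing the arrows turns the axioms for \<open>e_op\<close> into those for
      \<open>f_op\<close>.\<close>
    by (simp add: word_op_f_iff_e[symmetric] f_word_SomeD(1,3))
      (simp add: f_word_SomeD(2))
qed

section \<open>Subcrystals and transport of the crystal axioms\<close>

lemma is_crystal_subcrystal:
  assumes "is_crystal C" "stable C S" "S \<subseteq> elts C"
  shows "is_crystal (subcrystal C S)"
proof -
  have sub: "elts (subcrystal C S) = S" "wt (subcrystal C S) = wt C"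
    "eps (subcrystal C S) = eps C" "phi (subcrystal C S) = phi C"
    "e_op (subcrystal C S) = e_op C" "f_op (subcrystal C S) = f_op C"
    "stable (subcrystal C S) S \<longleftrightarrow> stable C S"
    by (simp_all add: subcrystal_def stable_def)
  show ?thesis
    using assms(1) subsetD[OF assms(3)] unfolding is_crystal_def sub
    by (intro conjI assms(2)) blast+
qed

text \<open>Only \<open>C\<close> is assumed to be a crystal; the axioms are carried to
  \<open>D\<close> along \<open>h\<close>. For tableaux this also yields that the operators stay
  among the quasi-ribbon tableaux, which is not built into \<open>tableau_crystal\<close>.\<close>

lemma crystal_isomorphicI:
  assumes C: "is_crystal C" and h: "bij_betw h (elts C) (elts D)"
    and wt: "\<And>b. b \<in> elts C \<Longrightarrow> wt D (h b) = wt C b"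
    and eps: "\<And>i b. b \<in> elts C \<Longrightarrow> eps D i (h b) = eps C i b"
    and phi: "\<And>i b. b \<in> elts C \<Longrightarrow> phi D i (h b) = phi C i b"
    and e: "\<And>i b. b \<in> elts C \<Longrightarrow> e_op D i (h b) = map_option h (e_op C i b)"
    and f: "\<And>i b. b \<in> elts C \<Longrightarrow> f_op D i (h b) = map_option h (f_op C i b)"
  shows "crystal_isomorphic C D"
proof -
  have D: "elts D = h ` elts C" and inj: "inj_on h (elts C)"
    using h by (auto simp: bij_betw_def)
  have st: "e_op C i b \<in> insert None (Some ` elts C)" "f_op C i b \<in> insert None (Some ` elts C)"
    if "b \<in> elts C" for i b
    using C that by (auto simp: is_crystal_def stable_def)
  have e_iff: "e_op D i (h b) = Some (h b') \<longleftrightarrow> e_op C i b = Some b'"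
    if "b \<in> elts C" "b' \<in> elts C" for i b b'
    using that st(1)[OF that(1), of i] inj by (auto simp: e inj_on_eq_iff)
  have f_iff: "f_op D i (h b) = Some (h b') \<longleftrightarrow> f_op C i b = Some b'"
    if "b \<in> elts C" "b' \<in> elts C" for i b b'
    using that st(2)[OF that(1), of i] inj by (auto simp: f inj_on_eq_iff)
  have "stable D (h ` elts C)"
    unfolding stable_def
  proof (intro allI ballI)
    fix i c assume "c \<in> h ` elts C"
    then obtain b where "b \<in> elts C" "c = h b" by blast
    then show "e_op D i c \<in> insert None (Some ` h ` elts C) \<and>
        f_op D i c \<in> insert None (Some ` h ` elts C)"
      using st[of b i] by (auto simp: e f)
  qed
  have c1: "phi C i b + eps C i b =
      (if weight_form (wt C b) (simple_root i) \<noteq> 0 then 1 else 0)" if "b \<in> elts C" for i b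
    using C that unfolding is_crystal_def by blast
  have c2: "int (eps C i b') = int (eps C i b) - 1 \<and>
      int (phi C i b') = int (phi C i b) + 1 \<and> wt C b' = wt C b + simple_root i"
    if "b \<in> elts C" "b' \<in> elts C" "e_op C i b = Some b'" for i b b'
    using C that unfolding is_crystal_def by blast
  have c3: "int (eps C i b') = int (eps C i b) + 1 \<and>
      int (phi C i b') = int (phi C i b) - 1 \<and> wt C b' = wt C b - simple_root i"
    if "b \<in> elts C" "b' \<in> elts C" "f_op C i b = Some b'" for i b b'
    using C that unfolding is_crystal_def by blast
  have c4: "f_op C i b = Some b' \<longleftrightarrow> e_op C i b' = Some b"
    if "b \<in> elts C" "b' \<in> elts C" for i b b'
    using C that unfolding is_crystal_def by blast
  have "is_crystal D"
    unfolding is_crystal_def D ball_simps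
  proof (intro conjI allI ballI)
    show "stable D (h ` elts C)" by fact
  qed (simp_all only: e_iff f_iff wt eps phi c1, (use c2 c3 c4 in blast)+)
  with C h show ?thesis
    unfolding crystal_isomorphic_def using wt eps phi f_iff by metis
qed

section \<open>Ribbon tableaux by adjacent entries\<close>

text \<open>
  \<open>R\<close> relates horizontally and \<open>C\<close> vertically adjacent nodes: the last node of a row lies
  directly above the first node of the next row.
\<close>

fun adjacent_ok :: "('a \<Rightarrow> 'a \<Rightarrow> bool) \<Rightarrow> ('a \<Rightarrow> 'a \<Rightarrow> bool) \<Rightarrow> 'a list list \<Rightarrow> bool" where
  "adjacent_ok R C [] \<longleftrightarrow> True"
| "adjacent_ok R C (r # T) \<longleftrightarrow> r \<noteq> [] \<and> successively R r \<and>
     (T \<noteq> [] \<longrightarrow> C (last r) (hd (hd T))) \<and> adjacent_ok R C T"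

lemma adjacent_ok_nonempty: "adjacent_ok R C T \<Longrightarrow> [] \<notin> set T"
  by (induction T) auto

lemma successively_conj:
  "successively (\<lambda>x y. R x y \<and> S x y) xs \<longleftrightarrow> successively R xs \<and> successively S xs"
  by (induction xs rule: induct_list012) auto

lemma adjacent_ok_map:
  "adjacent_ok R C (map (map g) T) \<longleftrightarrow>
    adjacent_ok (\<lambda>x y. R (g x) (g y)) (\<lambda>x y. C (g x) (g y)) T"
proof (induction T)
  case (Cons r T)
  show ?case
    by (cases T; cases "hd T = []")
      (use Cons in \<open>auto simp: successively_map last_map hd_map\<close>)
qed simp

lemma adjacent_ok_conj:
  "adjacent_ok (\<lambda>x y. R x y \<and> R' x y) (\<lambda>x y. C x y \<and> C' x y) T \<longleftrightarrow>
    adjacent_ok R C T \<and> adjacent_ok R' C' T"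
  by (induction T) (auto simp: successively_conj)

lemma adjacent_ok_mono:
  assumes "adjacent_ok R C T"
    and "\<And>x y. x \<in> set (concat T) \<Longrightarrow> y \<in> set (concat T) \<Longrightarrow> R x y \<Longrightarrow> R' x y"
    and "\<And>x y. x \<in> set (concat T) \<Longrightarrow> y \<in> set (concat T) \<Longrightarrow> C x y \<Longrightarrow> C' x y"
  shows "adjacent_ok R' C' T"
  using assms
proof (induction T)
  case (Cons r T)
  have "hd (hd T) \<in> set (concat T)" if "T \<noteq> []"
    using that Cons.prems(1) by (cases T) auto
  moreover have "successively R' r"
    using Cons.prems by (auto intro!: successively_mono[of R r])
  ultimately show ?case
    using Cons by auto
qed simp

text \<open>For a single relation the division into rows is irrelevant: horizontal and vertical
  neighbours alike are consecutive in \<open>concat T\<close>.\<close>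

lemma adjacent_ok_concat: "adjacent_ok R R T \<longleftrightarrow> [] \<notin> set T \<and> successively R (concat T)"
proof (induction T)
  case (Cons r T)
  show ?case
  proof (cases "T = [] \<or> [] \<in> set T")
    case True
    then show ?thesis
      using Cons.IH by auto
  next
    case False
    then obtain r' T' where "T = r' # T'" "r' \<noteq> []"
      by (cases T) auto
    then have "hd (concat T) = hd (hd T)" "concat T \<noteq> []"
      by simp_all
    then show ?thesis
      using False Cons.IH by (auto simp only: adjacent_ok.simps concat.simps successively_append_iff
        list.set insert_iff)
  qed
qed simp

lemma adjacent_ok_append:
  "adjacent_ok R C (T @ U) \<longleftrightarrow> adjacent_ok R C T \<and> adjacent_ok R C U \<and>
    (T \<noteq> [] \<and> U \<noteq> [] \<longrightarrow> C (last (last T)) (hd (hd U)))"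
  by (induction T) auto

text \<open>As \<open>R\<close> and \<open>C\<close> exclude each other, each pair of consecutive
  entries reveals whether the row continues or ends there.\<close>

lemma adjacent_ok_unique:
  assumes "adjacent_ok R C T" "adjacent_ok R C U" "concat T = concat U"
    and disj: "\<And>x y. R x y \<Longrightarrow> \<not> C x y"
  shows "T = U"
  using assms(1-3)
proof (induction T arbitrary: U)
  case Nil
  then show ?case by (cases U) auto
next
  have hd_concat: "concat T \<noteq> [] \<Longrightarrow> adjacent_ok R C T \<Longrightarrow> T \<noteq> [] \<and> hd (concat T) = hd (hd T)"
    for T :: "'a list list"
    by (cases T) auto
  \<comment> \<open>If one first row were a proper prefix of the other, the pair at its end would be
    vertically adjacent in one filling and horizontally adjacent in the other.\<close>
  have no_prefix: False
    if "adjacent_ok R C (r # T)" "adjacent_ok R C ((r @ us) # U)" "concat T = us @ concat U" "us \<noteq> []"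
    for r us :: "'a list" and T U
  proof -
    have "R (last r) (hd us)"
      using that by (auto simp: successively_append_iff)
    moreover have "C (last r) (hd us)"
      using that hd_concat[of T] by auto
    ultimately show False
      using disj by blast
  qed
  case (Cons r T)
  then obtain r' U' where U: "U = r' # U'"
    by (cases U) auto
  have "r @ concat T = r' @ concat U'"
    using Cons.prems(3) U by simp
  then obtain us where
    "r = r' @ us \<and> us @ concat T = concat U' \<or> r @ us = r' \<and> concat T = us @ concat U'"
    by (auto simp: append_eq_append_conv2)
  then have "r = r' \<and> concat T = concat U'"
    using no_prefix[of r T us U'] no_prefix[of r' U' us T] Cons.prems(1,2)
    unfolding U by (cases "us = []") (simp, metis)
  then show ?case
    using Cons.IH[of U'] Cons.prems(1,2) U by simp
qed

text \<open>Superposes two fillings of one shape, so that their conditions on neighbours can be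
  combined node by node.\<close>

lemma ex_zip_rows:
  "map length T = map length U \<Longrightarrow> \<exists>Z. map (map fst) Z = T \<and> map (map snd) Z = U"
proof (intro exI conjI)
  assume "map length T = map length U"
  then have "length T = length U" and "map length T = map length U"
    by (auto dest: map_eq_imp_length_eq)
  then show "map (map fst) (map2 zip T U) = T" "map (map snd) (map2 zip T U) = U"
    by (induction T U rule: list_induct2) auto
qed

section \<open>Ribbon diagrams in coordinates\<close>

lemma ribbon_Nil [simp]: "ribbon [] = {}"
  by (simp add: ribbon_def)

lemma ribbon_col_0 [simp]: "ribbon_col \<alpha> 0 = 0"
  by (simp add: ribbon_col_def)

lemma ribbon_col_Cons [simp]: "ribbon_col (a # \<alpha>) (Suc i) = (a - 1) + ribbon_col \<alpha> i"
  unfolding ribbon_col_def by (subst sum.lessThan_Suc_shift) simp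

lemma ribbon_Cons_0 [simp]: "(0, j) \<in> ribbon (a # \<alpha>) \<longleftrightarrow> j < a"
  by (simp add: ribbon_def)

lemma ribbon_Cons_Suc [simp]:
  "(Suc i, j) \<in> ribbon (a # \<alpha>) \<longleftrightarrow> a - 1 \<le> j \<and> (i, j - (a - 1)) \<in> ribbon \<alpha>"
  by (auto simp: ribbon_def)

lemma entry_Cons_0 [simp]: "entry (r # T) (0, j) = r ! j"
  by (simp add: entry_def)

lemma entry_Cons_Suc [simp]: "entry (r # T) (Suc i, j) = entry T (i, j - (length r - 1))"
  by (simp add: entry_def)

lemma ribbon_Cons:
  "ribbon (a # \<alpha>) = Pair 0 ` {..<a} \<union> (\<lambda>(i, j). (Suc i, j + (a - 1))) ` ribbon \<alpha>"
    (is "_ = ?R")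
proof (intro set_eqI iffI)
  fix p assume *: "p \<in> ribbon (a # \<alpha>)"
  obtain i j where p: "p = (i, j)" by force
  show "p \<in> ?R"
  proof (cases i)
    case (Suc i')
    then have "p = (\<lambda>(i, j). (Suc i, j + (a - 1))) (i', j - (a - 1))" "(i', j - (a - 1)) \<in> ribbon \<alpha>"
      using * p by auto
    then show ?thesis by blast
  qed (use * p in auto)
qed auto

lemma finite_ribbon [simp]: "finite (ribbon \<alpha>)"
  by (induction \<alpha>) (auto simp: ribbon_Cons)

lemma card_ribbon: "card (ribbon \<alpha>) = sum_list \<alpha>"
proof (induction \<alpha>)
  case (Cons a \<alpha>)
  have "card (ribbon (a # \<alpha>)) =
      card (Pair (0::nat) ` {..<a}) + card ((\<lambda>(i, j). (Suc i, j + (a - 1))) ` ribbon \<alpha>)"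
    unfolding ribbon_Cons by (rule card_Un_disjoint) auto
  also have "\<dots> = a + card (ribbon \<alpha>)"
    by (subst (1 2) card_image) (auto simp: inj_on_def)
  finally show ?case
    using Cons by simp
qed simp

lemma entry_image: "entry T ` ribbon (map length T) = set (concat T)"
proof (induction T)
  case (Cons r T)
  have "entry (r # T) ` ribbon (map length (r # T)) =
      (\<lambda>j. r ! j) ` {..<length r} \<union> entry T ` ribbon (map length T)"
    by (simp add: ribbon_Cons image_Un image_image case_prod_unfold)
  moreover have "(\<lambda>j. r ! j) ` {..<length r} = set r"
    by (auto simp: set_conv_nth)
  ultimately show ?case
    using Cons by simp
qed simp

text \<open>The ribbon has as many nodes as \<open>concat T\<close> has entries, so injectivity and
  distinctness both say that the set of entries has this cardinality.\<close>

lemma bij_betw_entry_iff: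
  "bij_betw (entry T) (ribbon (map length T)) A \<longleftrightarrow> distinct (concat T) \<and> set (concat T) = A"
proof -
  have "inj_on (entry T) (ribbon (map length T)) \<longleftrightarrow> distinct (concat T)"
    by (simp only: inj_on_iff_eq_card finite_ribbon entry_image card_ribbon length_concat[symmetric])
      (metis card_distinct distinct_card)
  then show ?thesis
    by (auto simp: bij_betw_def entry_image)
qed

text \<open>Common form of the two tableau definitions, which constrain all pairs of nodes in a row
  or column and not only neighbours.\<close>

definition ribbon_ok :: "('a \<Rightarrow> 'a \<Rightarrow> bool) \<Rightarrow> ('a \<Rightarrow> 'a \<Rightarrow> bool) \<Rightarrow> 'a list list \<Rightarrow> bool" where
  "ribbon_ok R C T \<longleftrightarrow>
     (\<forall>i j j'. (i, j) \<in> ribbon (map length T) \<and> (i, j') \<in> ribbon (map length T) \<and> j < j' \<longrightarrow>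
        R (entry T (i, j)) (entry T (i, j'))) \<and>
     (\<forall>i i' j. (i, j) \<in> ribbon (map length T) \<and> (i', j) \<in> ribbon (map length T) \<and> i < i' \<longrightarrow>
        C (entry T (i, j)) (entry T (i', j)))"

lemma ribbon_okD:
  assumes "ribbon_ok R C T"
  shows "\<And>i j j'. (i, j) \<in> ribbon (map length T) \<Longrightarrow> (i, j') \<in> ribbon (map length T) \<Longrightarrow> j < j' \<Longrightarrow>
      R (entry T (i, j)) (entry T (i, j'))"
    and "\<And>i i' j. (i, j) \<in> ribbon (map length T) \<Longrightarrow> (i', j) \<in> ribbon (map length T) \<Longrightarrow> i < i' \<Longrightarrow>
      C (entry T (i, j)) (entry T (i', j))"
  using assms by (auto simp: ribbon_ok_def)

text \<open>The top row shares only one column with the rest, namely that of its last node, which is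
  column 0 of \<open>T\<close>. Comparing with the corner of \<open>T\<close> suffices, since
  transitivity of \<open>C\<close> reaches the nodes below the corner.\<close>

lemma ribbon_ok_Cons:
  assumes C: "transp C" and ne: "r \<noteq> []" "[] \<notin> set T"
  shows "ribbon_ok R C (r # T) \<longleftrightarrow>
    sorted_wrt R r \<and> (T \<noteq> [] \<longrightarrow> C (last r) (hd (hd T))) \<and> ribbon_ok R C T"
    (is "?L \<longleftrightarrow> ?M")
proof -
  \<comment> \<open>The column of the last node of \<open>r\<close>, and hence the shift between the
    columns of \<open>T\<close> and those of \<open>r # T\<close>.\<close>
  define d where "d = length r - 1"
  have len: "length r = Suc d" and last: "last r = r ! d"
    using ne by (auto simp: d_def last_conv_nth)
  have origin: "(0, 0) \<in> ribbon (map length T)" "entry T (0, 0) = hd (hd T)" if "T \<noteq> []"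
  proof -
    obtain s U where "T = s # U" "s \<noteq> []"
      using \<open>T \<noteq> []\<close> ne(2) by (cases T) auto
    then show "(0, 0) \<in> ribbon (map length T)" "entry T (0, 0) = hd (hd T)"
      by (simp_all add: hd_conv_nth)
  qed
  show ?thesis
  proof
    assume L: ?L
    have "sorted_wrt R r"
      using ribbon_okD(1)[OF L, of 0] by (auto simp: sorted_wrt_iff_nth_less)
    moreover have "C (last r) (hd (hd T))" if "T \<noteq> []"
      using ribbon_okD(2)[OF L, of 0 d "Suc 0"] origin[OF that] by (simp add: len last)
    moreover have "ribbon_ok R C T"
      unfolding ribbon_ok_def
    proof (intro conjI allI impI; elim conjE)
      fix i j j' assume "(i, j) \<in> ribbon (map length T)" "(i, j') \<in> ribbon (map length T)" "j < j'"
      then show "R (entry T (i, j)) (entry T (i, j'))"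
        using ribbon_okD(1)[OF L, of "Suc i" "j + d" "j' + d"] by (simp add: len)
    next
      fix i i' j assume "(i, j) \<in> ribbon (map length T)" "(i', j) \<in> ribbon (map length T)" "i < i'"
      then show "C (entry T (i, j)) (entry T (i', j))"
        using ribbon_okD(2)[OF L, of "Suc i" "j + d" "Suc i'"] by (simp add: len)
    qed
    ultimately show ?M by blast
  next
    assume M: ?M
    then have T: "ribbon_ok R C T" by blast
    show ?L
      unfolding ribbon_ok_def
    proof (intro conjI allI impI; elim conjE)
      fix i j j'
      assume *: "(i, j) \<in> ribbon (map length (r # T))" "(i, j') \<in> ribbon (map length (r # T))" "j < j'"
      show "R (entry (r # T) (i, j)) (entry (r # T) (i, j'))"
      proof (cases i)
        case 0
        then show ?thesis using M * by (simp add: sorted_wrt_iff_nth_less)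
      next
        case (Suc k)
        then show ?thesis
          using * ribbon_okD(1)[OF T, of k "j - d" "j' - d"] by (auto simp: len)
      qed
    next
      fix i i' j
      assume *: "(i, j) \<in> ribbon (map length (r # T))" "(i', j) \<in> ribbon (map length (r # T))" "i < i'"
      then obtain k' where i': "i' = Suc k'" by (cases i') auto
      show "C (entry (r # T) (i, j)) (entry (r # T) (i', j))"
      proof (cases i)
        case 0
        then have j: "j = d" and k': "(k', 0) \<in> ribbon (map length T)"
          using * i' by (auto simp: len)
        then have "T \<noteq> []" by auto
        then have "C (last r) (entry T (0, 0))"
          using M origin by simp
        \<comment> \<open>Column 0 of \<open>T\<close> continues below the corner when the first row
          of \<open>T\<close> is a single node.\<close>
        moreover have "C (entry T (0, 0)) (entry T (k', 0))" if "k' \<noteq> 0"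
          using ribbon_okD(2)[OF T, of 0 0 k'] k' origin \<open>T \<noteq> []\<close> that by simp
        ultimately have "C (last r) (entry T (k', 0))"
          using C by (cases "k' = 0") (auto dest: transpD)
        then show ?thesis
          using 0 i' j by (simp add: len last)
      next
        case (Suc k)
        then show ?thesis
          using * i' ribbon_okD(2)[OF T, of k "j - d" k'] by (simp add: len)
      qed
    qed
  qed
qed

lemma adjacent_ok_iff_ribbon_ok:
  assumes "transp R" "transp C" "[] \<notin> set T"
  shows "adjacent_ok R C T \<longleftrightarrow> ribbon_ok R C T"
  using assms(3)
proof (induction T)
  case Nil
  show ?case by (simp add: ribbon_ok_def)
next
  case (Cons r T)
  then show ?case
    using assms(1,2) by (auto simp: ribbon_ok_Cons successively_conv_sorted_wrt)
qed

section \<open>Local descriptions of quasi-ribbon and standard ribbon tableaux\<close>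

definition quasi_row :: "letter \<Rightarrow> letter \<Rightarrow> bool" where
  "quasi_row a b \<longleftrightarrow> a < b \<or> a = b \<and> even_letter a"

definition quasi_column :: "letter \<Rightarrow> letter \<Rightarrow> bool" where
  "quasi_column a b \<longleftrightarrow> a < b \<or> a = b \<and> \<not> even_letter a"

lemma transp_quasi: "transp quasi_row" "transp quasi_column"
  by (auto intro!: transpI simp: quasi_row_def quasi_column_def)

lemma nonempty_rows: "map length T \<in> compositions \<longleftrightarrow> [] \<notin> set T"
  by (auto simp: compositions_def)

lemma quasi_ribbon_tableaux_iff:
  assumes "\<alpha> \<in> compositions"
  shows "T \<in> quasi_ribbon_tableaux \<alpha> \<longleftrightarrow>
    map length T = \<alpha> \<and> adjacent_ok quasi_row quasi_column T"
proof -
  have alt: "quasi_row a b \<longleftrightarrow> a \<le> b \<and> (\<not> even_letter a \<and> \<not> even_letter b \<longrightarrow> a < b)"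
    "quasi_column a b \<longleftrightarrow> a \<le> b \<and> (even_letter a \<and> even_letter b \<longrightarrow> a < b)" for a b
    by (auto simp: quasi_row_def quasi_column_def order_le_less)
  have "T \<in> quasi_ribbon_tableaux \<alpha> \<longleftrightarrow> ribbon_ok quasi_row quasi_column T" if "map length T = \<alpha>"
    unfolding that[symmetric] quasi_ribbon_tableaux_def fillings_def ribbon_ok_def mem_Collect_eq alt
    by blast
  moreover have "T \<in> quasi_ribbon_tableaux \<alpha> \<Longrightarrow> map length T = \<alpha>"
    by (simp add: quasi_ribbon_tableaux_def fillings_def)
  ultimately show ?thesis
    using assms adjacent_ok_iff_ribbon_ok[OF transp_quasi] nonempty_rows by blast
qed

lemma standard_ribbon_tableaux_iff:
  assumes "\<alpha> \<in> compositions"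
  shows "T \<in> standard_ribbon_tableaux \<alpha> \<longleftrightarrow> map length T = \<alpha> \<and>
    adjacent_ok (>) (<) T \<and> set (concat T) = {1..length (concat T)}"
proof -
  have "T \<in> standard_ribbon_tableaux \<alpha> \<longleftrightarrow> ribbon_ok (>) (<) T \<and>
      distinct (concat T) \<and> set (concat T) = {1..length (concat T)}" if "map length T = \<alpha>"
    unfolding that[symmetric] standard_ribbon_tableaux_def fillings_def ribbon_ok_def
      mem_Collect_eq bij_betw_entry_iff length_concat[symmetric] by blast
  moreover have "T \<in> standard_ribbon_tableaux \<alpha> \<Longrightarrow> map length T = \<alpha>"
    by (simp add: standard_ribbon_tableaux_def fillings_def)
  moreover have "distinct (concat T)" if "set (concat T) = {1..length (concat T)}"
    using that by (metis card_atLeastAtMost card_distinct diff_Suc_1)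
  moreover have "adjacent_ok (>) (<) T \<longleftrightarrow> ribbon_ok (>) (<) T" if "map length T = \<alpha>"
    using assms that by (intro adjacent_ok_iff_ribbon_ok) (auto simp flip: nonempty_rows)
  ultimately show ?thesis by blast
qed

section \<open>Insertion as sorting\<close>

text \<open>
  The order in which the labelled letters \<open>(w\<^sub>k, k)\<close> occupy the nodes from northwest to southeast:
  of two equal letters the one inserted later comes first precisely if the letter is even.
\<close>

definition prec :: "letter \<times> nat \<Rightarrow> letter \<times> nat \<Rightarrow> bool" where
  "prec p q \<longleftrightarrow> fst p < fst q \<or>
     fst p = fst q \<and> (if even_letter (fst p) then snd q < snd p else snd p < snd q)"

lemma transp_prec: "transp prec"
  by (rule transpI) (auto simp: prec_def split: if_splits)

lemma asymp_prec: "asymp prec"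
  by (rule asympI) (auto simp: prec_def split: if_splits)

text \<open>Were the heads different, each would occur in the tail of the other list, giving both
  \<open>P x y\<close> and \<open>P y x\<close>. Asymmetry also forbids repetitions, so equality of
  sets is enough.\<close>

lemma sorted_wrt_set_unique:
  assumes "asymp P"
  shows "sorted_wrt P xs \<Longrightarrow> sorted_wrt P ys \<Longrightarrow> set xs = set ys \<Longrightarrow> xs = ys"
proof (induction xs arbitrary: ys)
  case (Cons x xs)
  then obtain y ys' where ys: "ys = y # ys'"
    by (cases ys) auto
  have notin: "z \<notin> set zs" if "sorted_wrt P (z # zs)" for z zs
    using that asympD[OF assms, of z z] by auto
  have "x = y"
  proof (rule ccontr)
    assume "x \<noteq> y"
    then have "x \<in> set ys'" "y \<in> set xs"
      using Cons.prems(3) ys by (metis list.set_intros(1) set_ConsD)+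
    then show False
      using Cons.prems(1,2) ys asympD[OF assms, of x y] by auto
  qed
  moreover have "set xs = set ys'"
    using Cons.prems ys notin[of x xs] notin[of y ys'] \<open>x = y\<close> by (metis insert_ident list.simps(15))
  ultimately show ?case
    using Cons.IH[of ys'] Cons.prems(1,2) ys by simp
qed simp

lemma concat_first_nodes: "concat (first_nodes n T) = take n (concat T)"
  by (induction T arbitrary: n) auto

lemma concat_rest_nodes: "concat (rest_nodes n T) = drop n (concat T)"
  by (induction T arbitrary: n) auto

lemma concat_glue: "concat (glue n b T) = take n (concat T) @ b # drop n (concat T)"
proof -
  have "concat (attach_left b U) = b # concat U" for U
    by (cases U) auto
  then show ?thesis
    by (simp add: glue_def concat_first_nodes concat_rest_nodes)
qed

lemma successively_take: "successively R xs \<Longrightarrow> successively R (take n xs)"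
  by (metis append_take_drop_id successively_append_iff)

lemma successively_drop: "successively R xs \<Longrightarrow> successively R (drop n xs)"
  by (metis append_take_drop_id successively_append_iff)

lemma adjacent_ok_first_nodes: "adjacent_ok R C T \<Longrightarrow> adjacent_ok R C (first_nodes n T)"
proof (induction T arbitrary: n)
  case (Cons r T)
  have "hd (hd (first_nodes m T)) = hd (hd T) \<and> T \<noteq> []" if "first_nodes m T \<noteq> []" for m
    using that by (cases T) (auto split: if_splits)
  then show ?case
    using Cons by (auto simp: successively_take)
qed simp

lemma adjacent_ok_rest_nodes: "adjacent_ok R C T \<Longrightarrow> adjacent_ok R C (rest_nodes n T)"
  by (induction T arbitrary: n) (auto simp: successively_drop)

lemma adjacent_ok_attach_left:
  assumes "adjacent_ok R C T" "\<And>x. x \<in> set (concat T) \<Longrightarrow> R b x"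
  shows "adjacent_ok R C (attach_left b T)"
  using assms by (cases T) (auto simp: successively_Cons)

text \<open>The new node has at most two neighbours: one above it and one to its right. The
  hypothesis ranges over all entries because it is applied to a new label exceeding every old
  one.\<close>

lemma adjacent_ok_glue:
  assumes "adjacent_ok R C T" "\<And>x. x \<in> set (concat T) \<Longrightarrow> C x b \<and> R b x"
  shows "adjacent_ok R C (glue n b T)"
proof -
  let ?F = "first_nodes n T" and ?G = "rest_nodes n T"
  have "adjacent_ok R C (attach_left b ?G)"
    using assms(2) by (intro adjacent_ok_attach_left adjacent_ok_rest_nodes[OF assms(1)])
      (metis concat_rest_nodes in_set_dropD)
  moreover have "C (last (last ?F)) b" if "?F \<noteq> []"
  proof -
    have "last ?F \<in> set ?F" "last ?F \<noteq> []"
      using that adjacent_ok_nonempty[OF adjacent_ok_first_nodes[OF assms(1)], of n]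
      by (auto dest: last_in_set)
    then have "last (last ?F) \<in> set (concat ?F)"
      using last_in_set by fastforce
    then show ?thesis
      using assms(2) by (metis concat_first_nodes in_set_takeD)
  qed
  moreover have "hd (hd (attach_left b ?G)) = b"
    by (cases ?G) auto
  ultimately show ?thesis
    using adjacent_ok_first_nodes[OF assms(1)] by (simp add: glue_def adjacent_ok_append)
qed

section \<open>Invariants of labelled insertion\<close>

abbreviation labels_ok :: "('a \<times> nat) list list \<Rightarrow> bool" where
  "labels_ok \<equiv> adjacent_ok (\<lambda>p q. snd p > snd q) (\<lambda>p q. snd p < snd q)"

lemma zip_upt_snoc:
  "zip (w @ [b]) [1..<length (w @ [b]) + 1] = zip w [1..<length w + 1] @ [(b, length w + 1)]"
proof -
  have "[1..<length (w @ [b]) + 1] = [1..<length w + 1] @ [length w + 1]"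
    by simp
  then show ?thesis
    by (simp only:) (simp add: zip_append del: upt_Suc)
qed

lemma labelled_tableau_snoc:
  "labelled_tableau (w @ [b]) = insert_labelled (b, length w + 1) (labelled_tableau w)"
  unfolding labelled_tableau_def zip_upt_snoc by simp

text \<open>On the list of entries, insertion is one step of insertion sort; \<open>before\<close>
  is the negated stopping test of \<open>insert_pos\<close>.\<close>

lemma concat_insert_labelled:
  fixes p :: "letter \<times> nat"
  defines "before \<equiv> (\<lambda>q. \<not> (if even_letter (fst p) then fst p \<le> fst q else fst p < fst q))"
  shows "concat (insert_labelled p T) =
    takeWhile before (concat T) @ p # dropWhile before (concat T)"
proof -
  have "insert_pos (fst p) (map (map fst) T) = length (takeWhile before (concat T))"
    by (simp add: insert_pos_def before_def takeWhile_map o_def flip: map_concat)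
  then show ?thesis
    by (simp add: insert_labelled_def concat_glue flip: takeWhile_eq_take dropWhile_eq_drop)
qed

text \<open>The new label is the largest, so \<open>prec\<close> wants the new letter before all
  equal ones if it is even and after them if it is odd. The tests \<open>\<le>\<close> and
  \<open><\<close> of the insertion rule place it exactly there.\<close>

lemma sorted_insert_labelled:
  assumes "sorted_wrt prec (concat T)" "\<And>q. q \<in> set (concat T) \<Longrightarrow> snd q < snd p"
  shows "sorted_wrt prec (concat (insert_labelled p T))"
proof -
  define before :: "letter \<times> nat \<Rightarrow> bool" where
    "before = (\<lambda>q. \<not> (if even_letter (fst p) then fst p \<le> fst q else fst p < fst q))"
  define x where "x = concat T"
  have x: "sorted_wrt prec (takeWhile before x @ dropWhile before x)"
    using assms(1) by (simp add: x_def)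
  have "prec q p" if "q \<in> set (takeWhile before x)" for q
  proof -
    have "q \<in> set x" "before q"
      using that by (auto dest: set_takeWhileD)
    then show ?thesis
      using assms(2)[of q] by (cases "fst q = fst p") (auto simp: x_def prec_def before_def split: if_splits)
  qed
  \<comment> \<open>Only the first entry after the cut is known to fail the test; the later ones
    follow by sortedness and transitivity.\<close>
  moreover have "prec p q" if q: "q \<in> set (dropWhile before x)" for q
  proof -
    obtain t ts where t: "dropWhile before x = t # ts"
      using q by (cases "dropWhile before x") auto
    then have "\<not> before t"
      by (metis dropWhile_eq_Cons_conv)
    have ts: "set (t # ts) \<subseteq> set x"
      using t by (metis set_dropWhileD subsetI)
    have "prec p t"
      using \<open>\<not> before t\<close> assms(2)[of t] ts
      by (auto simp: x_def prec_def before_def split: if_splits)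
    moreover have "q = t \<or> prec t q"
      using x q by (auto simp: t sorted_wrt_append)
    ultimately show ?thesis
      using transpD[OF transp_prec] by blast
  qed
  ultimately show ?thesis
    using x
    unfolding concat_insert_labelled before_def[symmetric] x_def[symmetric] sorted_wrt_append
    by (auto intro: transpD[OF transp_prec])
qed

lemma mset_insert_labelled:
  "mset (concat (insert_labelled p T)) = add_mset p (mset (concat T))"
proof -
  have "mset (concat T) = mset (take n (concat T)) + mset (drop n (concat T))" for n
    by (metis append_take_drop_id mset_append)
  then show ?thesis
    unfolding insert_labelled_def concat_glue by simp
qed

lemma labelled_tableau_props:
  "mset (concat (labelled_tableau w)) = mset (zip w [1..<length w + 1])"
  "labels_ok (labelled_tableau w)"
  "sorted_wrt prec (concat (labelled_tableau w))"
proof (induction w rule: rev_induct)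
  case Nil
  show "mset (concat (labelled_tableau [])) = mset (zip [] [1..<length ([]::word) + 1])"
    "labels_ok (labelled_tableau [])" "sorted_wrt prec (concat (labelled_tableau []))"
    by (simp_all add: labelled_tableau_def)
next
  case (snoc b w)
  let ?L = "labelled_tableau w" and ?p = "(b, length w + 1)"
  have "set (concat ?L) = set (zip w [1..<length w + 1])"
    using snoc(1) by (metis set_mset_mset)
  \<comment> \<open>The old labels are positions in \<open>w\<close>, hence at most
    \<open>length w\<close>.\<close>
  then have less: "snd q < snd ?p" if "q \<in> set (concat ?L)" for q
    using that by (cases q) (auto dest!: set_zip_rightD simp del: set_concat upt_Suc)
  show "mset (concat (labelled_tableau (w @ [b]))) =
      mset (zip (w @ [b]) [1..<length (w @ [b]) + 1])"
    unfolding labelled_tableau_snoc zip_upt_snoc mset_insert_labelled snoc(1) by simp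
  show "labels_ok (labelled_tableau (w @ [b]))"
    unfolding labelled_tableau_snoc insert_labelled_def
    using snoc(2) less by (intro adjacent_ok_glue) blast+
  show "sorted_wrt prec (concat (labelled_tableau (w @ [b])))"
    unfolding labelled_tableau_snoc using snoc(3) less by (rule sorted_insert_labelled)
qed

text \<open>The list \<open>x\<close> consists of the letters of \<open>w\<close> paired with their
  positions, in any order. Labels count from 1 while list indices count from 0, hence the
  shift.\<close>

definition spells :: "word \<Rightarrow> (letter \<times> nat) list \<Rightarrow> bool" where
  "spells w x \<longleftrightarrow> length x = length w \<and> snd ` set x = {1..length w} \<and>
     (\<forall>p \<in> set x. w ! (snd p - 1) = fst p)"

lemma set_zip_upt: "set (zip w [1..<length w + 1]) = {(w ! (k - 1), k) | k. k \<in> {1..length w}}"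
proof -
  have "\<exists>i<length w. w ! (k - 1) = w ! i \<and> k = Suc i" if "Suc 0 \<le> k" "k \<le> length w" for k
    using that by (intro exI[of _ "k - 1"]) auto
  then show ?thesis
    by (force simp: set_zip simp del: upt_Suc)
qed

lemma spells_set:
  assumes "spells w x"
  shows "set x = set (zip w [1..<length w + 1])"
  unfolding set_zip_upt
proof (intro set_eqI iffI)
  fix p assume "p \<in> set x"
  then have "snd p \<in> {1..length w}" "fst p = w ! (snd p - 1)"
    using assms by (auto simp: spells_def)
  then show "p \<in> {(w ! (k - 1), k) | k. k \<in> {1..length w}}"
    by (cases p) auto
next
  fix p assume "p \<in> {(w ! (k - 1), k) | k. k \<in> {1..length w}}"
  then obtain k where "p = (w ! (k - 1), k)" "k \<in> snd ` set x"
    using assms by (auto simp: spells_def)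
  moreover from this obtain q where "q \<in> set x" "k = snd q"
    by blast
  ultimately show "p \<in> set x"
    using assms by (simp add: spells_def)
qed

lemma spells_zip: "spells w (zip w [1..<length w + 1])"
proof -
  have "snd ` set (zip w [1..<length w + 1]) = set [1..<length w + 1]"
    by (simp only: set_map[symmetric] map_snd_zip length_upt)
  then have "snd ` set (zip w [1..<length w + 1]) = {1..length w}"
    by (simp only: set_upt) auto
  moreover have "w ! (snd p - 1) = fst p" if "p \<in> set (zip w [1..<length w + 1])" for p
    using that unfolding set_zip_upt by auto
  ultimately show ?thesis
    unfolding spells_def by (metis add_diff_cancel_right' length_upt length_zip min.idem)
qed

lemma spells_mset: "mset x = mset y \<Longrightarrow> spells w x \<Longrightarrow> spells w y"
  unfolding spells_def by (metis mset_eq_length set_mset_mset)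

lemma spells_labelled_tableau: "spells w (concat (labelled_tableau w))"
  using spells_mset[OF labelled_tableau_props(1)[symmetric] spells_zip] .

text \<open>The word fixes the set of labelled letters, \<open>prec\<close> their order, and the
  labels the division into rows. This identifies the result of insertion without running it.\<close>

lemma labelled_tableau_eqI:
  assumes "labels_ok L" "sorted_wrt prec (concat L)" "spells w (concat L)"
  shows "labelled_tableau w = L"
proof -
  have "set (concat (labelled_tableau w)) = set (concat L)"
    using spells_set spells_labelled_tableau assms(3) by metis
  then have "concat (labelled_tableau w) = concat L"
    using sorted_wrt_set_unique[OF asymp_prec] labelled_tableau_props(3) assms(2) by blast
  then show ?thesis
    using adjacent_ok_unique[OF labelled_tableau_props(2) assms(1)] by simp
qed

lemma spells_distinct: "spells w x \<Longrightarrow> distinct (map snd x)"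
  by (rule card_distinct) (simp add: spells_def)

lemma spells_unique: "spells v x \<Longrightarrow> spells w x \<Longrightarrow> v = w"
proof (rule nth_equalityI)
  assume *: "spells v x" "spells w x"
  then show "length v = length w" by (simp add: spells_def)
  fix k assume "k < length v"
  then have "Suc k \<in> snd ` set x"
    using * by (simp add: spells_def)
  then obtain p where "p \<in> set x" "k = snd p - 1" by force
  then show "v ! k = w ! k"
    using * by (simp add: spells_def)
qed

lemma ex_spells:
  assumes "snd ` set x = {1..length x}"
  shows "\<exists>w. spells w x"
proof -
  have "distinct (map snd x)"
    by (rule card_distinct) (simp add: assms)
  \<comment> \<open>Labels are distinct, so the choice can only return the pair \<open>q\<close>
    itself.\<close>
  then have fst: "fst (SOME p. p \<in> set x \<and> snd p = snd q) = fst q" if "q \<in> set x" for q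
    using that someI[of "\<lambda>p. p \<in> set x \<and> snd p = snd q" q]
    by (metis (mono_tags, lifting) distinct_map inj_on_def)
  have "spells (map (\<lambda>k. fst (SOME p. p \<in> set x \<and> snd p = Suc k)) [0..<length x]) x"
    unfolding spells_def
  proof (intro conjI ballI)
    fix q assume q: "q \<in> set x"
    then have "snd q \<in> {1..length x}"
      using assms by blast
    then obtain k where "snd q = Suc k" "k < length x"
      by (cases "snd q") auto
    then show "map (\<lambda>k. fst (SOME p. p \<in> set x \<and> snd p = Suc k)) [0..<length x] ! (snd q - 1) = fst q"
      using fst[OF q] by simp
  qed (use assms in simp_all)
  then show ?thesis ..
qed

section \<open>The operators depend only on the descents\<close>

lemma between_half_up: "i \<le> a \<Longrightarrow> a \<le> half_up i \<Longrightarrow> a = i \<or> a = half_up i"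
  using less_half_up_iff[of a i] by auto

lemma active_less_trans: "active_less i k l \<Longrightarrow> active_less i l m \<Longrightarrow> active_less i k m"
  by (auto simp: active_less_def split: if_splits)

lemma active_less_asym: "active_less i k l \<Longrightarrow> \<not> active_less i l k"
  by (auto simp: active_less_def split: if_splits)

lemma prec_fst_le: "prec p q \<Longrightarrow> fst p \<le> fst q"
  by (auto simp: prec_def)

text \<open>From northwest to southeast, labels of copies of \<open>i\<close> approach the active
  end of the word. Those of copies of \<open>half_up i\<close> recede from it, by the opposite
  parity, as \<open>prec_eq_upper\<close> records.\<close>

lemma prec_eq_lower:
  "fst p = i \<Longrightarrow> fst q = i \<Longrightarrow> prec p q \<longleftrightarrow> active_less i (snd q) (snd p)"
  by (auto simp: prec_def active_less_def split: if_splits)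

lemma prec_eq_upper:
  "fst p = half_up i \<Longrightarrow> fst q = half_up i \<Longrightarrow> prec p q \<longleftrightarrow> active_less i (snd p) (snd q)"
  by (auto simp: prec_def active_less_def split: if_splits)

lemma active_positions_spells:
  assumes "spells w x"
  shows "active_positions i w = {snd p - 1 | p. p \<in> set x \<and> fst p \<in> {i, half_up i}}" (is "_ = ?R")
proof (intro set_eqI iffI)
  fix k assume k: "k \<in> active_positions i w"
  then have "Suc k \<in> snd ` set x"
    using assms by (auto simp: spells_def active_positions_def)
  then obtain p where "p \<in> set x" "snd p = Suc k" by force
  moreover from this have "fst p = w ! k"
    using assms by (metis diff_Suc_1 spells_def)
  ultimately have "p \<in> set x" "fst p \<in> {i, half_up i}" "k = snd p - 1"
    using k by (simp_all add: active_positions_def)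
  then show "k \<in> ?R"
    by blast
next
  fix k assume "k \<in> ?R"
  then obtain p where p: "p \<in> set x" "fst p \<in> {i, half_up i}" "k = snd p - 1"
    by blast
  then have "snd p \<in> {1..length w}" "w ! k = fst p"
    using assms by (auto simp: spells_def)
  then show "k \<in> active_positions i w"
    using p by (auto simp: active_positions_def)
qed

lemma spells_snd_nth:
  assumes "spells w x" "l < length x"
  shows "1 \<le> snd (x ! l)" "snd (x ! l) - 1 < length w" "w ! (snd (x ! l) - 1) = fst (x ! l)"
proof -
  have "snd (x ! l) \<in> {1..length w}"
    using assms nth_mem unfolding spells_def by blast
  then show "1 \<le> snd (x ! l)" "snd (x ! l) - 1 < length w" by auto
  show "w ! (snd (x ! l) - 1) = fst (x ! l)"
    using assms by (simp add: spells_def)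
qed

lemma spells_snd_eq_iff:
  assumes "spells w x" "l < length x" "m < length x"
  shows "snd (x ! l) = snd (x ! m) \<longleftrightarrow> l = m"
  using nth_eq_iff_index_eq[OF spells_distinct[OF assms(1)], of l m] assms(2,3) by simp

text \<open>Restates extremality among positions of \<open>w\<close> as extremality among nodes of
  \<open>x\<close>. All labels are at least 1, so the truncated subtraction preserves their
  order.\<close>

lemma first_active_global:
  assumes "spells w x" "m < length x"
  shows "first_active i w (snd (x ! m) - 1) \<longleftrightarrow> fst (x ! m) \<in> {i, half_up i} \<and>
    (\<forall>l < length x. l \<noteq> m \<and> fst (x ! l) \<in> {i, half_up i} \<longrightarrow>
      active_less i (snd (x ! m)) (snd (x ! l)))"
proof -
  have pos: "1 \<le> snd p" if "p \<in> set x" for p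
    using that spells_snd_nth(1)[OF assms(1)] by (metis in_set_conv_nth)
  have shift: "active_less i (k - 1) (l - 1) \<longleftrightarrow> active_less i k l"
    if "1 \<le> k" "1 \<le> l" for k l
    using that by (auto simp: active_less_def)
  have act: "snd (x ! l) - 1 \<in> active_positions i w \<longleftrightarrow> fst (x ! l) \<in> {i, half_up i}"
    if "l < length x" for l
    using spells_snd_nth[OF assms(1) that] by (auto simp: active_positions_def)
  have "(\<forall>k \<in> active_positions i w. k = snd (x ! m) - 1 \<or> active_less i (snd (x ! m) - 1) k) \<longleftrightarrow>
      (\<forall>p \<in> set x. fst p \<in> {i, half_up i} \<longrightarrow>
        snd p - 1 = snd (x ! m) - 1 \<or> active_less i (snd (x ! m) - 1) (snd p - 1))"
    unfolding active_positions_spells[OF assms(1)] by blast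
  also have "\<dots> \<longleftrightarrow> (\<forall>p \<in> set x. fst p \<in> {i, half_up i} \<longrightarrow>
        snd p = snd (x ! m) \<or> active_less i (snd (x ! m)) (snd p))"
    using pos shift nth_mem[OF assms(2)] by (metis diff_add_inverse2 le_add_diff_inverse2)
  also have "\<dots> \<longleftrightarrow> (\<forall>l < length x. fst (x ! l) \<in> {i, half_up i} \<longrightarrow>
        l = m \<or> active_less i (snd (x ! m)) (snd (x ! l)))"
    using spells_snd_eq_iff[OF assms(1) _ assms(2)] by (auto simp: all_set_conv_all_nth)
  finally show ?thesis
    using act[OF assms(2)] by (auto simp: first_active_def)
qed

text \<open>
  Along the nodes carrying \<open>i\<close> or \<open>half_up i\<close> the labels first move towards the active end of the
  word and then away from it, so a local extremum is a global one.
\<close>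

lemma first_active_local:
  assumes "spells w x" "sorted_wrt prec x" "m < length x"
  shows "first_active i w (snd (x ! m) - 1) \<longleftrightarrow> fst (x ! m) \<in> {i, half_up i} \<and>
    (\<forall>l. m = Suc l \<and> fst (x ! l) \<in> {i, half_up i} \<longrightarrow>
      active_less i (snd (x ! m)) (snd (x ! l))) \<and>
    (Suc m < length x \<and> fst (x ! Suc m) \<in> {i, half_up i} \<longrightarrow>
      active_less i (snd (x ! m)) (snd (x ! Suc m)))"
    (is "_ \<longleftrightarrow> ?act m \<and> ?left \<and> ?right")
proof
  assume "first_active i w (snd (x ! m) - 1)"
  then show "?act m \<and> ?left \<and> ?right"
    using assms(3) unfolding first_active_global[OF assms(1,3)] by auto
next
  assume *: "?act m \<and> ?left \<and> ?right"
  have prec: "prec (x ! k) (x ! l)" if "k < l" "l < length x" for k l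
    using assms(2) that by (simp add: sorted_wrt_iff_nth_less)
  \<comment> \<open>Letters increase weakly along \<open>x\<close> and none lies between
    \<open>i\<close> and \<open>half_up i\<close>, so the active nodes form an interval.\<close>
  have between: "?act k" if "l \<le> k" "k \<le> n" "n < length x" "?act l" "?act n" for k l n
  proof -
    have "fst (x ! l) \<le> fst (x ! k)" "fst (x ! k) \<le> fst (x ! n)"
      using that prec prec_fst_le by (metis le_neq_implies_less le_less_trans order_refl)+
    then have "i \<le> fst (x ! k)" "fst (x ! k) \<le> half_up i"
      using that(4,5) less_half_up[of i] by auto
    then show ?thesis using between_half_up by blast
  qed
  have "active_less i (snd (x ! m)) (snd (x ! l))" if l: "l < length x" "l \<noteq> m" "?act l" for l
  proof (cases "l < m")
    case True
    then obtain n where m: "m = Suc n" by (cases m) auto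
    then have act_n: "?act n" and less_n: "active_less i (snd (x ! m)) (snd (x ! n))"
      using between[of l n m] True l * assms(3) by auto
    have ln: "fst (x ! l) \<le> fst (x ! n)" "l = n \<or> prec (x ! l) (x ! n)"
      using prec[of l n] True m assms(3) prec_fst_le by (cases "l = n"; fastforce)+
    have nm: "prec (x ! n) (x ! m)"
      using prec m assms(3) by simp
    \<comment> \<open>If \<open>n\<close> carries \<open>i\<close>, so does the earlier node
      \<open>l\<close>, and labels of copies of \<open>i\<close> only approach the active end. If
      \<open>n\<close> carries \<open>half_up i\<close>, so does \<open>m\<close>, and
      \<open>prec_eq_upper\<close> contradicts the local condition at \<open>m\<close>.\<close>
    show ?thesis
    proof (cases "fst (x ! n) = i")
      case True
      then have "fst (x ! l) = i"
        using ln(1) l(3) less_half_up[of i] by auto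
      then show ?thesis
        using ln(2) True less_n prec_eq_lower active_less_trans by blast
    next
      case False
      then have "fst (x ! n) = half_up i" "fst (x ! m) = half_up i"
        using act_n * prec_fst_le[OF nm] less_half_up[of i] by auto
      then show ?thesis
        using nm less_n prec_eq_upper active_less_asym by blast
    qed
  next
    case False
    with l(2) have "m < l" by simp
    then have act_n: "?act (Suc m)" and less_n: "active_less i (snd (x ! m)) (snd (x ! Suc m))"
      using between[of m "Suc m" l] l * by auto
    have nl: "fst (x ! Suc m) \<le> fst (x ! l)" "Suc m = l \<or> prec (x ! Suc m) (x ! l)"
      using prec[of "Suc m" l] \<open>m < l\<close> l(1) prec_fst_le by (cases "Suc m = l"; fastforce)+
    have mn: "prec (x ! m) (x ! Suc m)"
      using prec \<open>m < l\<close> l(1) by simp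
    show ?thesis
    proof (cases "fst (x ! Suc m) = i")
      case True
      then have "fst (x ! m) = i"
        using prec_fst_le[OF mn] * less_half_up[of i] by auto
      then show ?thesis
        using mn True less_n prec_eq_lower active_less_asym by blast
    next
      case False
      then have "fst (x ! Suc m) = half_up i" "fst (x ! l) = half_up i"
        using act_n nl(1) l(3) less_half_up[of i] by auto
      then show ?thesis
        using nl(2) less_n prec_eq_upper active_less_trans by blast
    qed
  qed
  then show "first_active i w (snd (x ! m) - 1)"
    using * unfolding first_active_global[OF assms(1,3)] by blast
qed

lemma spells_update:
  assumes "spells w x" "m < length x"
  shows "spells (w[snd (x ! m) - 1 := a]) (x[m := (a, snd (x ! m))])"
proof -
  let ?x = "x[m := (a, snd (x ! m))]" and ?w = "w[snd (x ! m) - 1 := a]"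
  have "map snd ?x = map snd x"
    by (simp add: map_update) (metis assms(2) list_update_id nth_map)
  then have "snd ` set ?x = snd ` set x"
    by (metis set_map)
  moreover have "?w ! (snd (?x ! l) - 1) = fst (?x ! l)" if "l < length x" for l
  proof (cases "l = m")
    case True
    then show ?thesis using assms spells_snd_nth(2)[OF assms] by simp
  next
    case False
    then have "snd (x ! l) - 1 \<noteq> snd (x ! m) - 1"
      using spells_snd_eq_iff[OF assms(1) that assms(2)] spells_snd_nth(1)[OF assms(1)] that assms(2)
      by (metis eq_diff_iff)
    then show ?thesis using False that spells_snd_nth(3)[OF assms(1) that] by simp
  qed
  ultimately show ?thesis
    using assms(1) by (simp add: spells_def all_set_conv_all_nth)
qed

text \<open>Apart from \<open>m\<close> itself, copies of \<open>i\<close> lie before node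
  \<open>m\<close> and copies of \<open>half_up i\<close> after it. Its extreme label makes it last
  among the former or first among the latter, so either letter fits there.\<close>

lemma sorted_update:
  assumes "spells w x" "sorted_wrt prec x" "m < length x"
    and first: "first_active i w (snd (x ! m) - 1)" and a: "a \<in> {i, half_up i}"
  shows "sorted_wrt prec (x[m := (a, snd (x ! m))])"
  unfolding sorted_wrt_iff_nth_less
proof (intro allI impI)
  fix k l assume kl: "k < l" "l < length (x[m := (a, snd (x ! m))])"
  have prec: "prec (x ! k) (x ! l)"
    using assms(2) kl by (simp add: sorted_wrt_iff_nth_less)
  have act: "fst (x ! m) \<in> {i, half_up i}"
    and less: "\<And>l. l < length x \<Longrightarrow> l \<noteq> m \<Longrightarrow> fst (x ! l) \<in> {i, half_up i} \<Longrightarrow>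
      active_less i (snd (x ! m)) (snd (x ! l))"
    using first unfolding first_active_global[OF assms(1,3)] by blast+
  have prec_less: "prec p q" if "fst p < fst q" for p q
    using that by (simp add: prec_def)
  consider "k \<noteq> m" "l \<noteq> m" | "l = m" "k \<noteq> m" | "k = m" "l \<noteq> m"
    using kl(1) by fastforce
  then show "prec (x[m := (a, snd (x ! m))] ! k) (x[m := (a, snd (x ! m))] ! l)"
  proof cases
    case 1
    then show ?thesis using prec by simp
  next
    case 2
    \<comment> \<open>Otherwise \<open>m\<close> would carry \<open>half_up i\<close> too, and the
      earlier node \<open>k\<close> would have the label nearer to the active end.\<close>
    have "fst (x ! k) \<noteq> half_up i"
    proof
      assume k: "fst (x ! k) = half_up i"
      then have "fst (x ! m) = half_up i"
        using prec_fst_le[OF prec] act 2 less_half_up[of i] by auto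
      then show False
        using prec prec_eq_upper[OF k, of "x ! m"] less[of k] k 2 kl active_less_asym by auto
    qed
    moreover have "fst (x ! k) \<le> half_up i"
      using prec_fst_le[OF prec] act 2 less_half_up[of i] by auto
    ultimately have "fst (x ! k) = i \<or> fst (x ! k) < i"
      using less_half_up_iff[of "fst (x ! k)" i] by auto
    then have "fst (x ! k) < a \<or> fst (x ! k) = i \<and> a = i"
      using a less_half_up[of i] by auto
    then have "prec (x ! k) (a, snd (x ! m))"
      using prec_less[of "x ! k" "(a, snd (x ! m))"] less[of k] 2 kl
        prec_eq_lower[of "x ! k" i "(a, snd (x ! m))"] by auto
    then show ?thesis
      using 2 kl assms(3) by simp
  next
    case 3
    have "fst (x ! l) \<noteq> i"
    proof
      assume l: "fst (x ! l) = i"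
      then have "fst (x ! m) = i"
        using prec_fst_le[OF prec] act 3 less_half_up[of i] by auto
      then show False
        using prec_eq_lower[of "x ! m" i "x ! l"] prec less[of l] l 3 kl active_less_asym by auto
    qed
    moreover have "i \<le> fst (x ! l)"
      using prec_fst_le[OF prec] act 3 less_half_up[of i] by auto
    ultimately have "fst (x ! l) = half_up i \<or> half_up i < fst (x ! l)"
      using less_half_up_iff[of "fst (x ! l)" i] by (metis order_antisym not_less_iff_gr_or_eq)
    then have "a < fst (x ! l) \<or> fst (x ! l) = half_up i \<and> a = half_up i"
      using a less_half_up[of i] by auto
    then have "prec (a, snd (x ! m)) (x ! l)"
      using prec_less[of "(a, snd (x ! m))" "x ! l"] less[of l] 3 kl
        prec_eq_upper[of "(a, snd (x ! m))" i "x ! l"] by auto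
    then show ?thesis
      using 3 kl assms(3) by simp
  qed
qed

text \<open>The criterion \<open>first_active_local\<close> involves only the letters and the
  comparison of labels at neighbouring nodes, and both lists agree on these.\<close>

lemma first_active_transfer:
  assumes x: "spells w x" "sorted_wrt prec x" and y: "spells u y" "sorted_wrt prec y"
    and fst: "map fst x = map fst y"
    and descents: "\<And>m. Suc m < length x \<Longrightarrow>
      snd (x ! m) < snd (x ! Suc m) \<longleftrightarrow> snd (y ! m) < snd (y ! Suc m)"
    and m: "m < length x" and first: "first_active i w (snd (x ! m) - 1)"
  shows "first_active i u (snd (y ! m) - 1)"
proof -
  have len: "length y = length x"
    using fst by (metis length_map)
  have fst_nth: "fst (y ! l) = fst (x ! l)" if "l < length x" for l
    using fst that len by (metis nth_map)
  \<comment> \<open>Neighbouring labels are distinct, so agreement on ascents gives agreement on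
    descents.\<close>
  have flip: "snd (x ! Suc l) < snd (x ! l) \<longleftrightarrow> snd (y ! Suc l) < snd (y ! l)"
    if "Suc l < length x" for l
    using descents[OF that] spells_snd_eq_iff[OF x(1), of l "Suc l"]
      spells_snd_eq_iff[OF y(1), of l "Suc l"] that len by auto
  have "active_less i (snd (x ! l)) (snd (x ! Suc l)) \<longleftrightarrow>
      active_less i (snd (y ! l)) (snd (y ! Suc l))"
    "active_less i (snd (x ! Suc l)) (snd (x ! l)) \<longleftrightarrow>
      active_less i (snd (y ! Suc l)) (snd (y ! l))" if "Suc l < length x" for l
    using flip[OF that] descents[OF that] by (simp_all add: active_less_def)
  then show ?thesis
    using first m unfolding first_active_local[OF x m] first_active_local[OF y m[folded len]]
    by (auto simp: len fst_nth)
qed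

text \<open>Both words change at the same node \<open>m\<close> and receive the same letter
  \<open>a\<close>, although the two labels of \<open>m\<close> may name different
  positions.\<close>

lemma word_op_transfer:
  assumes x: "spells w x" "sorted_wrt prec x" and y: "spells u y" "sorted_wrt prec y"
    and fst: "map fst x = map fst y"
    and descents: "\<And>m. Suc m < length x \<Longrightarrow>
      snd (x ! m) < snd (x ! Suc m) \<longleftrightarrow> snd (y ! m) < snd (y ! Suc m)"
    and g: "g \<in> {e_letter, f_letter}"
  obtains "word_op (g i) i w = None" "word_op (g i) i u = None"
  | m a where "m < length x" "sorted_wrt prec (x[m := (a, snd (x ! m))])"
      "word_op (g i) i w = Some (w[snd (x ! m) - 1 := a])"
      "word_op (g i) i u = Some (u[snd (y ! m) - 1 := a])"
proof (cases "active_positions i w = {}")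
  case True
  have empty_iff: "active_positions i v = {} \<longleftrightarrow> fst ` set z \<inter> {i, half_up i} = {}"
    if "spells v z" for v z
    unfolding active_positions_spells[OF that] by blast
  have "fst ` set x = fst ` set y"
    using fst by (metis set_map)
  then have "active_positions i u = {}"
    using True empty_iff[OF x(1)] empty_iff[OF y(1)] by blast
  then show ?thesis
    using True that(1) by (simp add: word_op_inactive)
next
  case False
  then obtain k where k: "first_active i w k"
    using ex_first_active by blast
  then have "k \<in> active_positions i w"
    by (simp add: first_active_def)
  then obtain p where "p \<in> set x" "k = snd p - 1"
    unfolding active_positions_spells[OF x(1)] by blast
  then obtain m where m: "m < length x" "k = snd (x ! m) - 1"
    by (auto simp: in_set_conv_nth)
  have len: "length y = length x"
    using fst by (metis length_map)
  have first: "first_active i w (snd (x ! m) - 1)" "first_active i u (snd (y ! m) - 1)"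
    using k m first_active_transfer[OF x y fst descents m(1)] by simp_all
  have w: "w ! (snd (x ! m) - 1) = fst (x ! m)" and u: "u ! (snd (y ! m) - 1) = fst (x ! m)"
    using spells_snd_nth(3)[OF x(1) m(1)] spells_snd_nth(3)[OF y(1)] m(1) fst len
    by (metis nth_map)+
  note ops = word_op_first_active[OF first(1), of "g i", unfolded w]
    word_op_first_active[OF first(2), of "g i", unfolded u]
  show ?thesis
  proof (cases "g i (fst (x ! m))")
    case None
    then show ?thesis
      using that(1) ops by simp
  next
    case (Some a)
    then have "a \<in> {i, half_up i}"
      using g by (auto simp: e_letter_def f_letter_def split: if_splits)
    then have "sorted_wrt prec (x[m := (a, snd (x ! m))])"
      using sorted_update[OF x m(1) first(1)] by blast
    then show ?thesis
      using Some m(1) that(2) ops by simp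
  qed
qed

section \<open>Recording tableaux and reading words\<close>

text \<open>Numbers the nodes in the order of the reading word, starting at \<open>n\<close>; rows
  are read from right to left, hence \<open>rev\<close>. For \<open>n = 1\<close> this is the
  recording labelling of reading words of shape \<alpha>.\<close>

fun row_labels :: "nat \<Rightarrow> nat list \<Rightarrow> nat list list" where
  "row_labels n [] = []"
| "row_labels n (a # \<alpha>) = rev [n..<n + a] # row_labels (n + a) \<alpha>"

lemma map_length_row_labels [simp]: "map length (row_labels n \<alpha>) = \<alpha>"
  by (induction \<alpha> arbitrary: n) auto

lemma reading_row_labels: "reading (row_labels n \<alpha>) = [n..<n + sum_list \<alpha>]"
proof (induction \<alpha> arbitrary: n)
  case (Cons a \<alpha>)
  have "reading (row_labels n (a # \<alpha>)) = [n..<n + a] @ [n + a..<n + a + sum_list \<alpha>]"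
    using Cons by (simp add: reading_def)
  also have "\<dots> = [n..<n + a + sum_list \<alpha>]"
    by (rule upt_add_eq_append[symmetric]) simp
  finally show ?case
    by (simp add: add.assoc)
qed (simp add: reading_def)

lemma adjacent_ok_row_labels: "\<alpha> \<in> compositions \<Longrightarrow> adjacent_ok (>) (<) (row_labels n \<alpha>)"
proof (induction \<alpha> arbitrary: n)
  case (Cons a \<alpha>)
  then have \<alpha>: "\<alpha> \<in> compositions" and a: "0 < a"
    by (auto simp: compositions_def)
  have "successively (>) (rev [n..<n + a])"
    by (simp add: successively_if_sorted_wrt)
  moreover have "last (rev [n..<n + a]) < hd (hd (row_labels (n + a) \<alpha>))" if "\<alpha> \<noteq> []"
    using that \<alpha> a by (cases \<alpha>) (auto simp: compositions_def last_rev hd_rev)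
  moreover have "row_labels (n + a) \<alpha> \<noteq> [] \<Longrightarrow> \<alpha> \<noteq> []"
    by auto
  ultimately show ?case
    using Cons.IH[OF \<alpha>] a by (auto simp del: upt_Suc)
qed simp

lemma reading_map: "reading (map (map g) T) = map g (reading T)"
  by (simp add: reading_def map_concat rev_map o_def)

lemma mset_reading: "mset (reading T) = mset (concat T)"
  by (induction T) (auto simp: reading_def)

lemma length_reading: "length (reading T) = sum_list (map length T)"
  by (metis length_concat mset_reading size_mset)

text \<open>Reading the labels yields 1, 2, 3 and so on, so reading the pairs attaches to each
  letter its position in the reading word. Passing from \<open>reading\<close> to
  \<open>concat\<close> only permutes the pairs.\<close>

lemma spells_reading:
  assumes "map (map snd) L = row_labels 1 \<alpha>"
  shows "spells (reading (map (map fst) L)) (concat L)"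
proof -
  have "map length L = \<alpha>"
    using arg_cong[OF assms, of "map length"] by (simp add: o_def)
  moreover have "map snd (reading L) = [1..<1 + sum_list \<alpha>]"
    using assms by (simp only: reading_map[symmetric] reading_row_labels)
  ultimately have "reading L =
      zip (reading (map (map fst) L)) [1..<length (reading (map (map fst) L)) + 1]"
    unfolding reading_map by (metis add.commute length_map length_reading zip_map_fst_snd)
  then have "spells (reading (map (map fst) L)) (reading L)"
    using spells_zip by metis
  then show ?thesis
    using spells_mset mset_reading by metis
qed

text \<open>The shape alone decides each comparison: labels descend within a row and ascend from one
  row to the next.\<close>

lemma labels_ok_descents:
  assumes "labels_ok L" "labels_ok M" "map length L = map length M" "Suc m < length (concat L)"
  shows "snd (concat L ! m) < snd (concat L ! Suc m) \<longleftrightarrow> snd (concat M ! m) < snd (concat M ! Suc m)"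
proof -
  obtain Z where Z: "map (map fst) Z = L" "map (map snd) Z = M"
    using ex_zip_rows[OF assms(3)] by blast
  let ?P = "\<lambda>p q. snd (fst p) < snd (fst q) \<longleftrightarrow> snd (snd p) < snd (snd q)"
  have "adjacent_ok
      (\<lambda>p q. snd (fst p) > snd (fst q) \<and> snd (snd p) > snd (snd q))
      (\<lambda>p q. snd (fst p) < snd (fst q) \<and> snd (snd p) < snd (snd q)) Z"
    using assms(1,2) unfolding Z[symmetric] adjacent_ok_map adjacent_ok_conj by simp
  \<comment> \<open>The equivalence \<open>?P\<close> holds for both kinds of neighbours, so the
    rows can now be forgotten.\<close>
  then have "adjacent_ok ?P ?P Z"
    by (rule adjacent_ok_mono) auto
  then have "successively ?P (concat Z)"
    by (simp add: adjacent_ok_concat)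
  moreover have "concat L = map fst (concat Z)" "concat M = map snd (concat Z)"
    by (simp_all add: Z[symmetric] map_concat)
  ultimately show ?thesis
    using assms(4) by (simp add: successively_conv_nth)
qed

lemma ex_rows:
  assumes "length xs = sum_list \<alpha>"
  shows "\<exists>T. map length T = \<alpha> \<and> concat T = xs"
  using assms
proof (induction \<alpha> arbitrary: xs)
  case (Cons a \<alpha>)
  then obtain T where "map length T = \<alpha>" "concat T = drop a xs"
    by (metis add_diff_cancel_left' length_drop sum_list.Cons)
  then show ?case
    using Cons.prems by (intro exI[of _ "take a xs # T"]) simp
qed simp

lemma rows_eqI:
  assumes "concat T = concat U" "map length T = map length U"
  shows "T = U"
proof -
  have "length T = length U"
    using assms(2) by (rule map_eq_imp_length_eq)
  then show ?thesis
    using assms(2,1) by (induction T U rule: list_induct2) auto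
qed

lemma labels_ok_iff: "labels_ok L \<longleftrightarrow> adjacent_ok (>) (<) (map (map snd) L)"
  by (simp add: adjacent_ok_map)

section \<open>The correspondence between words and pairs of tableaux\<close>

lemma Q_tableau_standard: "Q_tableau w \<in> standard_ribbon_tableaux (map length (Q_tableau w))"
  "map length (Q_tableau w) \<in> compositions"
proof -
  let ?L = "labelled_tableau w"
  have ok: "adjacent_ok (>) (<) (Q_tableau w)"
    using labelled_tableau_props(2)[of w] by (simp add: labels_ok_iff Q_tableau_def)
  then show comp: "map length (Q_tableau w) \<in> compositions"
    by (simp only: nonempty_rows adjacent_ok_nonempty not_False_eq_True)
  have concat: "concat (Q_tableau w) = map snd (concat ?L)"
    by (simp add: Q_tableau_def map_concat)
  have "set (concat (Q_tableau w)) = {1..length (concat (Q_tableau w))}"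
    using spells_labelled_tableau[of w] unfolding concat set_map length_map spells_def by metis
  then show "Q_tableau w \<in> standard_ribbon_tableaux (map length (Q_tableau w))"
    using ok standard_ribbon_tableaux_iff[OF comp] by blast
qed

lemma map_length_P_tableau: "map length (P_tableau w) = map length (Q_tableau w)"
  by (simp add: Q_tableau_def o_def flip: labelled_tableau_P)

text \<open>For equal letters \<open>prec\<close> compares labels according to parity. Labels
  descend in rows and ascend in columns, so horizontal neighbours can be equal only if even,
  vertical ones only if odd.\<close>

lemma P_tableau_quasi_ribbon: "P_tableau w \<in> quasi_ribbon_tableaux (map length (Q_tableau w))"
proof -
  let ?L = "labelled_tableau w"
  have "successively prec (concat ?L)"
    by (intro successively_if_sorted_wrt labelled_tableau_props(3))
  then have "adjacent_ok prec prec ?L"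
    using adjacent_ok_nonempty[OF labelled_tableau_props(2)] by (simp add: adjacent_ok_concat)
  then have "adjacent_ok (\<lambda>p q. prec p q \<and> snd p > snd q) (\<lambda>p q. prec p q \<and> snd p < snd q) ?L"
    using labelled_tableau_props(2) by (simp add: adjacent_ok_conj)
  then have "adjacent_ok (\<lambda>p q. quasi_row (fst p) (fst q)) (\<lambda>p q. quasi_column (fst p) (fst q)) ?L"
    by (rule adjacent_ok_mono) (auto simp: prec_def quasi_row_def quasi_column_def split: if_splits)
  then have "adjacent_ok quasi_row quasi_column (P_tableau w)"
    by (simp add: adjacent_ok_map flip: labelled_tableau_P)
  then show ?thesis
    by (simp add: quasi_ribbon_tableaux_iff[OF Q_tableau_standard(2)] map_length_P_tableau)
qed

text \<open>Both tableaux together recover every letter with its position in the word.\<close>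

lemma inj_on_P_tableau: "inj_on P_tableau (words_with_Q T)"
proof (rule inj_onI)
  fix v w assume "v \<in> words_with_Q T" "w \<in> words_with_Q T" and P: "P_tableau v = P_tableau w"
  let ?L = "labelled_tableau v" and ?M = "labelled_tableau w"
  have Q: "map (map snd) ?L = map (map snd) ?M"
    using \<open>v \<in> _\<close> \<open>w \<in> _\<close> by (simp add: words_with_Q_def Q_tableau_def)
  have "map fst (concat ?L) = map fst (concat ?M)" "map snd (concat ?L) = map snd (concat ?M)"
    using P Q by (simp_all add: map_concat flip: labelled_tableau_P)
  then have "concat ?L = concat ?M"
    by (metis zip_map_fst_snd)
  then show "v = w"
    using spells_unique spells_labelled_tableau by metis
qed

text \<open>Superposing \<open>U\<close> and \<open>T\<close> makes neighbours comparable under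
  \<open>prec\<close>, so the pairs are sorted. By \<open>labelled_tableau_eqI\<close> they form the
  labelled tableau of the word they spell, and insertion need not be inverted.\<close>

lemma P_tableau_surj:
  assumes "\<alpha> \<in> compositions" "T \<in> standard_ribbon_tableaux \<alpha>" "U \<in> quasi_ribbon_tableaux \<alpha>"
  shows "\<exists>w \<in> words_with_Q T. P_tableau w = U"
proof -
  have T: "map length T = \<alpha>" "adjacent_ok (>) (<) T" "set (concat T) = {1..length (concat T)}"
    using assms(2) by (simp_all only: standard_ribbon_tableaux_iff[OF assms(1)])
  have U: "map length U = \<alpha>" "adjacent_ok quasi_row quasi_column U"
    using assms(3) by (simp_all only: quasi_ribbon_tableaux_iff[OF assms(1)])
  obtain L where L: "map (map fst) L = U" "map (map snd) L = T"
    using ex_zip_rows[of U T] T(1) U(1) by auto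
  have labels: "labels_ok L"
    using T(2) by (simp add: labels_ok_iff L)
  have "adjacent_ok (\<lambda>p q. quasi_row (fst p) (fst q)) (\<lambda>p q. quasi_column (fst p) (fst q)) L"
    using U(2) by (simp add: adjacent_ok_map flip: L(1))
  then have "adjacent_ok (\<lambda>p q. quasi_row (fst p) (fst q) \<and> snd p > snd q)
      (\<lambda>p q. quasi_column (fst p) (fst q) \<and> snd p < snd q) L"
    using labels by (simp add: adjacent_ok_conj)
  then have "adjacent_ok prec prec L"
    by (rule adjacent_ok_mono) (auto simp: prec_def quasi_row_def quasi_column_def)
  then have sorted: "sorted_wrt prec (concat L)"
    by (simp add: adjacent_ok_concat successively_conv_sorted_wrt[OF transp_prec])
  have "concat T = map snd (concat L)"
    by (simp add: map_concat flip: L(2))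
  then have "snd ` set (concat L) = {1..length (concat L)}"
    using T(3) by (metis length_map set_map)
  then obtain w where "spells w (concat L)"
    using ex_spells by blast
  then have "labelled_tableau w = L"
    using labels sorted by (intro labelled_tableau_eqI)
  then have "w \<in> words_with_Q T" "P_tableau w = U"
    using L by (simp_all add: words_with_Q_def Q_tableau_def flip: labelled_tableau_P)
  then show ?thesis by blast
qed

lemma wt_reading_P_tableau: "wt word_crystal (reading (P_tableau w)) = wt word_crystal w"
proof -
  have wt: "wt word_crystal v = sum_mset (image_mset epsilon (mset v))" for v
    by (simp add: word_crystal_def sum_mset_sum_list flip: mset_map)
  have "mset (reading (P_tableau w)) = mset (map fst (concat (labelled_tableau w)))"
    by (simp add: mset_reading map_concat flip: labelled_tableau_P)
  also have "\<dots> = mset (map fst (zip w [1..<length w + 1]))"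
    by (simp only: mset_map labelled_tableau_props(1))
  also have "\<dots> = mset w"
    by (subst map_fst_zip) (simp_all del: upt_Suc)
  finally show ?thesis
    by (simp add: wt)
qed

text \<open>The tableau \<open>P_tableau w\<close> carries two labellings of its shape: by positions
  in \<open>w\<close>, giving \<open>L\<close>, and by positions in its reading word, giving
  \<open>M\<close>. By \<open>word_op_transfer\<close> the operators change the same node in both,
  while all labels stay.\<close>

lemma word_op_P_tableau:
  fixes w :: word
  assumes g: "g \<in> {e_letter, f_letter}"
  defines "\<alpha> \<equiv> map length (Q_tableau w)"
  shows "map_option (the_inv_into (fillings \<alpha>) reading) (word_op (g i) i (reading (P_tableau w))) =
      map_option P_tableau (word_op (g i) i w)" (is ?commute)
    and "\<And>w'. word_op (g i) i w = Some w' \<Longrightarrow> Q_tableau w' = Q_tableau w"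
proof -
  define L where "L = labelled_tableau w"
  have L_fst: "map (map fst) L = P_tableau w" and L_snd: "map (map snd) L = Q_tableau w"
    by (simp_all add: L_def labelled_tableau_P Q_tableau_def)
  have len_L: "map length L = \<alpha>"
    by (simp add: \<alpha>_def o_def flip: L_snd)
  have \<alpha>: "\<alpha> \<in> compositions"
    unfolding \<alpha>_def by (rule Q_tableau_standard)
  obtain M where M_fst: "map (map fst) M = P_tableau w" and M_snd: "map (map snd) M = row_labels 1 \<alpha>"
    using ex_zip_rows[of "P_tableau w" "row_labels 1 \<alpha>"] by (auto simp: map_length_P_tableau \<alpha>_def)
  have len_M: "map length M = \<alpha>"
    using arg_cong[OF M_snd, of "map length"] by (simp add: o_def)
  have labels: "labels_ok L" "labels_ok M"
    using labelled_tableau_props(2) adjacent_ok_row_labels[OF \<alpha>]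
    by (auto simp: L_def labels_ok_iff M_snd)
  let ?x = "concat L" and ?y = "concat M" and ?u = "reading (P_tableau w)"
  have x: "spells w ?x" "sorted_wrt prec ?x"
    unfolding L_def by (rule spells_labelled_tableau labelled_tableau_props(3))+
  have y_spells: "spells ?u ?y"
    using spells_reading[OF M_snd] by (simp add: M_fst)
  have fst_eq: "map fst ?x = map fst ?y"
    by (simp add: map_concat L_fst M_fst)
  have len_xy: "length ?x = length ?y"
    using fst_eq by (metis length_map)
  have descents: "snd (?x ! m) < snd (?x ! Suc m) \<longleftrightarrow> snd (?y ! m) < snd (?y ! Suc m)"
    if "Suc m < length ?x" for m
    using labels_ok_descents[OF labels] len_L len_M that by simp
  \<comment> \<open>At neighbouring nodes \<open>prec\<close> depends only on the letters and on
    which label is larger, so it passes from \<open>L\<close> to \<open>M\<close>.\<close>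
  have "successively prec ?y"
    unfolding successively_conv_nth
  proof (intro allI impI)
    fix m assume m: "Suc m < length ?y"
    then have "prec (?x ! m) (?x ! Suc m)"
      using x(2) len_xy by (simp add: sorted_wrt_iff_nth_less)
    moreover have "fst (?y ! l) = fst (?x ! l)" if "l < length ?y" for l
      using fst_eq len_xy that by (metis nth_map)
    moreover have "snd (?y ! m) \<noteq> snd (?y ! Suc m)"
      using spells_snd_eq_iff[OF y_spells, of m "Suc m"] m by simp
    ultimately show "prec (?y ! m) (?y ! Suc m)"
      using descents[of m] m len_xy by (auto simp: prec_def split: if_splits)
  qed
  then have y: "spells ?u ?y" "sorted_wrt prec ?y"
    using y_spells by (simp_all add: successively_conv_sorted_wrt[OF transp_prec])
  have "?commute \<and> (\<forall>w'. word_op (g i) i w = Some w' \<longrightarrow> Q_tableau w' = Q_tableau w)"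
  proof (rule word_op_transfer[OF x y fst_eq descents g])
    assume "word_op (g i) i w = None" "word_op (g i) i ?u = None"
    then show ?thesis by simp
  next
    fix m a
    let ?x' = "?x[m := (a, snd (?x ! m))]" and ?y' = "?y[m := (a, snd (?y ! m))]"
    let ?w' = "w[snd (?x ! m) - 1 := a]" and ?u' = "?u[snd (?y ! m) - 1 := a]"
    assume m: "m < length ?x" and sorted: "sorted_wrt prec ?x'"
      and ops: "word_op (g i) i w = Some ?w'" "word_op (g i) i ?u = Some ?u'"
    \<comment> \<open>The updated lists are put back into rows of the unchanged shape.\<close>
    obtain L' where L': "map length L' = \<alpha>" "concat L' = ?x'"
      using ex_rows[of ?x' \<alpha>] len_L by (auto simp: length_concat)
    obtain M' where M': "map length M' = \<alpha>" "concat M' = ?y'"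
      using ex_rows[of ?y' \<alpha>] len_M by (auto simp: length_concat)
    have "map snd ?x' = map snd ?x" "map snd ?y' = map snd ?y"
      using m len_xy by (simp_all add: map_update) (metis list_update_id nth_map)+
    then have "map (map snd) L' = map (map snd) L" "map (map snd) M' = map (map snd) M"
      using L' M' len_L len_M by (auto intro!: rows_eqI simp: o_def simp flip: map_concat)
    then have L'_snd: "map (map snd) L' = Q_tableau w"
      and M'_snd: "map (map snd) M' = row_labels 1 \<alpha>"
      by (simp_all only: L_snd M_snd)
    have M'_fst: "map (map fst) M' = map (map fst) L'"
      using L' M' fst_eq by (auto intro!: rows_eqI simp: o_def map_update simp flip: map_concat)
    have "labels_ok L'"
      using labels(1) by (simp add: labels_ok_iff L'_snd L_snd)
    then have lab': "labelled_tableau ?w' = L'"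
      using sorted spells_update[OF x(1) m] by (intro labelled_tableau_eqI) (simp_all add: L')
    then have Q': "Q_tableau ?w' = Q_tableau w" and P': "P_tableau ?w' = map (map fst) L'"
      using Q_tableau_def[of ?w'] labelled_tableau_P[of ?w'] by (simp_all only: L'_snd)
    \<comment> \<open>The pairs \<open>?y'\<close> spell both the reading word of the new tableau
      and the updated reading word, which therefore coincide.\<close>
    have "spells (reading (P_tableau ?w')) ?y'"
      using spells_reading[OF M'_snd] by (simp only: M'_fst P' M')
    moreover have "spells ?u' ?y'"
      using spells_update[OF y(1)] m len_xy by simp
    ultimately have "?u' = reading (P_tableau ?w')"
      by (rule spells_unique[symmetric])
    moreover have "P_tableau ?w' \<in> fillings \<alpha>"
      using L' unfolding P' fillings_def by (simp add: o_def)
    ultimately show ?thesis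
      using Q' by (simp add: ops the_inv_into_f_f[OF inj_on_reading])
  qed
  then show ?commute and "\<And>w'. word_op (g i) i w = Some w' \<Longrightarrow> Q_tableau w' = Q_tableau w"
    by blast+
qed

section \<open>The isomorphism and the decomposition\<close>

lemma stable_words_with_Q: "stable word_crystal (words_with_Q T)"
  unfolding stable_def
proof (intro allI ballI)
  fix i w assume w: "w \<in> words_with_Q T"
  have "word_op (g i) i w \<in> insert None (Some ` words_with_Q T)" if "g \<in> {e_letter, f_letter}" for g
    using word_op_P_tableau(2)[OF that, of i w] w
    by (cases "word_op (g i) i w") (auto simp: words_with_Q_def)
  then show "e_op word_crystal i w \<in> insert None (Some ` words_with_Q T) \<and>
      f_op word_crystal i w \<in> insert None (Some ` words_with_Q T)"
    by (simp add: word_crystal_def)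
qed

lemma words_with_Q_isomorphic:
  assumes "\<alpha> \<in> compositions" "T \<in> standard_ribbon_tableaux \<alpha>"
  shows "crystal_isomorphic (subcrystal word_crystal (words_with_Q T)) (tableau_crystal \<alpha>)"
proof (rule crystal_isomorphicI[where h = P_tableau])
  let ?C = "subcrystal word_crystal (words_with_Q T)"
  have Q: "Q_tableau w = T" "map length (Q_tableau w) = \<alpha>" if "w \<in> elts ?C" for w
    using that assms(2)
    by (simp_all add: subcrystal_def words_with_Q_def standard_ribbon_tableaux_def fillings_def)
  show "is_crystal ?C"
    by (rule is_crystal_subcrystal[OF is_crystal_word stable_words_with_Q])
      (simp add: word_crystal_def)
  have "P_tableau ` words_with_Q T = quasi_ribbon_tableaux \<alpha>"
    using P_tableau_surj[OF assms] P_tableau_quasi_ribbon Q(2)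
    by (force simp: subcrystal_def)
  then show "bij_betw P_tableau (elts ?C) (elts (tableau_crystal \<alpha>))"
    using inj_on_P_tableau by (simp add: bij_betw_def subcrystal_def tableau_crystal_def)
  fix w assume w: "w \<in> elts ?C"
  show "wt (tableau_crystal \<alpha>) (P_tableau w) = wt ?C w"
    using wt_reading_P_tableau by (simp add: tableau_crystal_def subcrystal_def)
  fix i
  have op: "map_option (the_inv_into (fillings \<alpha>) reading) (word_op (g i) i (reading (P_tableau w))) =
      map_option P_tableau (word_op (g i) i w)" if "g \<in> {e_letter, f_letter}" for g
    using word_op_P_tableau(1)[OF that, of w i] Q(2)[OF w] by simp
  \<comment> \<open>The values of \<open>eps\<close> and \<open>phi\<close> record only whether an
    operator is defined, and \<open>map_option\<close> preserves this.\<close>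
  then have none: "word_op (g i) i (reading (P_tableau w)) = None \<longleftrightarrow> word_op (g i) i w = None"
    if "g \<in> {e_letter, f_letter}" for g
    using that by (metis option.map_disc_iff)
  show "eps (tableau_crystal \<alpha>) i (P_tableau w) = eps ?C i w"
    "phi (tableau_crystal \<alpha>) i (P_tableau w) = phi ?C i w"
    using none[of e_letter] none[of f_letter]
    by (simp_all add: tableau_crystal_def subcrystal_def word_crystal_def del: not_None_eq)
  show "e_op (tableau_crystal \<alpha>) i (P_tableau w) = map_option P_tableau (e_op ?C i w)"
    "f_op (tableau_crystal \<alpha>) i (P_tableau w) = map_option P_tableau (f_op ?C i w)"
    using op[of e_letter] op[of f_letter]
    by (simp_all add: tableau_crystal_def subcrystal_def word_crystal_def)
qed

theorem theorem3p7:
  shows "(\<forall>\<alpha> \<in> compositions. \<forall>T \<in> standard_ribbon_tableaux \<alpha>.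
            crystal_isomorphic (subcrystal word_crystal (words_with_Q T)) (tableau_crystal \<alpha>)) \<and>
         is_direct_sum word_crystal
            (SIGMA \<alpha> : compositions. standard_ribbon_tableaux \<alpha>)
            (\<lambda>(\<alpha>, T). words_with_Q T)"
proof (intro conjI ballI)
  show "is_direct_sum word_crystal (SIGMA \<alpha> : compositions. standard_ribbon_tableaux \<alpha>)
      (\<lambda>(\<alpha>, T). words_with_Q T)"
    unfolding is_direct_sum_def
  proof (intro conjI ballI is_crystal_word)
    \<comment> \<open>A common word determines \<open>T\<close> as its recording tableau, and
      \<open>T\<close> determines \<alpha> as its list of row lengths.\<close>
    show "disjoint_family_on (\<lambda>(\<alpha>, T). words_with_Q T)
        (SIGMA \<alpha> : compositions. standard_ribbon_tableaux \<alpha>)"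
      by (auto simp: disjoint_family_on_def words_with_Q_def standard_ribbon_tableaux_def fillings_def)
    have "w \<in> (\<Union>k \<in> (SIGMA \<alpha> : compositions. standard_ribbon_tableaux \<alpha>).
        case k of (\<alpha>, T) \<Rightarrow> words_with_Q T)" for w
      \<comment> \<open>Every word lies in the piece indexed by its own recording tableau.\<close>
      by (rule UN_I[of "(map length (Q_tableau w), Q_tableau w)"])
        (simp_all add: Q_tableau_standard words_with_Q_def)
    then show "elts word_crystal = (\<Union>k \<in> (SIGMA \<alpha> : compositions. standard_ribbon_tableaux \<alpha>).
        case k of (\<alpha>, T) \<Rightarrow> words_with_Q T)"
      by (auto simp: word_crystal_def)
  qed (auto simp: stable_words_with_Q)
qed (rule words_with_Q_isomorphic)

end
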